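(* Let $f\in F_0(G)$, let $(f_t)$ be the interacting particle system started from $f$, and set $\bar f(\xi,t)=\mathbb E_f f_t(\xi)$ for $\xi\in V\cup E$, $t\ge0$. Then for each $\xi$, $t\mapsto\bar f(\xi,t)$ is differentiable and $$\frac{d}{dt}\bar f(\xi,t)=\big(\mathcal L_G\bar f(\cdot,t)\big)(\xi)\quad(\xi\in V_0\cup E,\ t\ge0),\qquad \bar f(\xi,0)=f(\xi)\ (\xi\in V\cup E),\qquad \bar f(x,t)=f(x)\ (x\in V_1,\ t\ge0).$$ Explicitly: $\frac{d}{dt}\mathbb E_f f_t(x)=\sum_{y\sim x}k_{xy}\,e_{xy}\cdot\mathbb E_f f_t(\langle x,y\rangle)$ for $x\in V_0$, and $\frac{d}{dt}\mathbb E_f f_t(\langle x,y\rangle)\cdot e_{xy}=\frac{\mathbb E_f f_t(y)}{m_y}-\frac{\mathbb E_f f_t(x)}{m_x}$ for $\langle x,y\rangle\in E$.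
   Context: A graph is a quadruple $G=(V,E,K,m)$: $V$ is a finite or countable set of nodes, which are elements of a real Hilbert space $\mathcal H$ with inner product "$\cdot$" and norm $|\cdot|$; $E$ is a set of undirected edges (at most one edge between any two distinct nodes, no self-loops); the edge between $x$ and $y$ is written $\langle x,y\rangle=\langle y,x\rangle$, and $y\sim x$ means this edge exists; $K=(k_{xy})_{x,y\in V}$ with $k_{xy}=k_{yx}\ge0$ and $k_{xy}=0$ if there is no edge; $m=(m_x)_{x\in V}$ with $m_x>0$. Let $e_{xy}=(y-x)/|y-x|$. Assume $d_0=\sup_{x\in V}\#\{y:y\sim x\}<\infty$, set $d=\max\{d_0,2\}$, and assume $M=\max\{\sup_{x\in V}m_x^{-1},\sup_{\langle x,y\rangle\in E}k_{xy}\}<\infty$. $V=V_0\cup V_1$ is a fixed partition into disjoint sets. $F(G)$ is the set of functions $f$ assigning a real number $f(x)$ to each $x\in V$ and a vector $f(\langle x,y\rangle)\in\mathcal H$ that is a real multiple of $y-x$ to each edge. For $1\le\alpha<\infty$, $\|f\|_\alpha=\big(\sum_{x\in V}|f(x)|^\alpha/m_x+\sum_{\langle x,y\rangle\in E}k_{xy}|f(\langle x,y\rangle)|^\alpha\big)^{1/\alpha}$, and $\|f\|_\infty=\max\{\sup_x|f(x)|,\sup_{\langle x,y\rangle}|f(\langle x,y\rangle)|\}$. $F_0(G)$ is the set of $f\in F(G)$ with finitely many nonzero values such that $|f(x)|\in\mathbb Z$ and $|f(\langle x,y\rangle)|\in\mathbb Z$ for all nodes and edges. The operator $\mathcal L_G:F(G)\to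 F(G)$ is $(\mathcal L_Gf)(x)=\sum_{y\sim x}k_{xy}\,e_{xy}\cdot f(\langle x,y\rangle)$ for $x\in V$ and $(\mathcal L_Gf)(\langle x,y\rangle)=\big(f(y)/m_y-f(x)/m_x\big)e_{xy}$ for $\langle x,y\rangle\in E$. The interacting particle system (IPS) $(f_t)_{t\ge0}$ is the continuous-time Markov jump process on $F_0(G)$ with the following transitions from state $f$: (i) for each $x\in V$, at rate $|f(x)|/m_x$, for every $y\sim x$ the edge value $f(\langle x,y\rangle)$ is replaced by $f(\langle x,y\rangle)+\mathrm{sgn}(f(x))\,e_{yx}$ (all other values unchanged); (ii) for each edge $\langle x,y\rangle$, at rate $k_{xy}|f(\langle x,y\rangle)|$, with $s=\mathrm{sgn}(f(\langle x,y\rangle)\cdot e_{xy})$, the value $f(x)$ is replaced by $f(x)+s$ if $x\in V_0$ and $f(y)$ by $f(y)-s$ if $y\in V_0$ (values at nodes of $V_1$ never change; this rule is symmetric in $x,y$). $P_f,\mathbb E_f$ denote probability and expectation given $f_0=f$. *)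

theory Defs
  imports "HOL-Analysis.Analysis"
begin

text \<open>
  Graph conventions.  Nodes are points of a real Hilbert space 'h
  (class real_inner + complete_space).  An undirected edge between x and y
  is represented by the doubleton set {x, y}.  The weights are
  k :: 'h set => real (on edges) and m :: 'h => real (on nodes).
  A function f in F(G) is a pair (fv, fe) of a node part fv :: 'h => real
  and an edge part fe :: 'h set => 'h.
  The unit vector e_xy = (y - x)/|y - x| is sgn (y - x).
\<close>

type_synonym 'h state = "('h \<Rightarrow> real) \<times> ('h set \<Rightarrow> 'h)"

definition unit_vec :: "'h::real_normed_vector \<Rightarrow> 'h \<Rightarrow> 'h" where
  "unit_vec x y = sgn (y - x)"

definition other_end :: "'h \<Rightarrow> 'h set \<Rightarrow> 'h" where
  "other_end z \<epsilon> = the_elem (\<epsilon> - {z})"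

definition graph_ok ::
  "('h::{real_inner,complete_space}) set \<Rightarrow> 'h set set \<Rightarrow> ('h set \<Rightarrow> real) \<Rightarrow> ('h \<Rightarrow> real)
   \<Rightarrow> 'h set \<Rightarrow> 'h set \<Rightarrow> bool" where
  "graph_ok V E k m V0 V1 \<longleftrightarrow>
     countable V \<and>
     (\<forall>\<epsilon>\<in>E. \<exists>x y. \<epsilon> = {x, y} \<and> x \<noteq> y \<and> x \<in> V \<and> y \<in> V) \<and>
     (\<forall>\<epsilon>\<in>E. k \<epsilon> \<ge> 0) \<and>
     (\<forall>x\<in>V. m x > 0) \<and>
     (\<exists>D::nat. \<forall>x\<in>V. finite {y. {x, y} \<in> E} \<and> card {y. {x, y} \<in> E} \<le> D) \<and>
     (\<exists>M::real. (\<forall>x\<in>V. 1 / m x \<le> M) \<and> (\<forall>\<epsilon>\<in>E. k \<epsilon> \<le> M)) \<and>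
     V0 \<union> V1 = V \<and> V0 \<inter> V1 = {}"

definition F0 :: "('h::real_normed_vector) set \<Rightarrow> 'h set set \<Rightarrow> 'h state set" where
  "F0 V E = {(fv, fe).
      finite {x. fv x \<noteq> 0} \<and> finite {\<epsilon>. fe \<epsilon> \<noteq> 0} \<and>
      (\<forall>x. x \<notin> V \<longrightarrow> fv x = 0) \<and> (\<forall>\<epsilon>. \<epsilon> \<notin> E \<longrightarrow> fe \<epsilon> = 0) \<and>
      (\<forall>x\<in>V. \<bar>fv x\<bar> \<in> \<int>) \<and>
      (\<forall>x y. {x, y} \<in> E \<longrightarrow> (\<exists>c::real. fe {x, y} = c *\<^sub>R (y - x)) \<and> norm (fe {x, y}) \<in> \<int>)}"

datatype 'h event = NodeEv 'h | EdgeEv "'h set"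

definition events :: "'h set \<Rightarrow> 'h set set \<Rightarrow> 'h event set" where
  "events V E = NodeEv ` V \<union> EdgeEv ` E"

fun ev_rate :: "('h set \<Rightarrow> real) \<Rightarrow> ('h \<Rightarrow> real) \<Rightarrow> ('h::real_normed_vector) state \<Rightarrow> 'h event \<Rightarrow> real" where
  "ev_rate k m f (NodeEv x) = \<bar>fst f x\<bar> / m x"
| "ev_rate k m f (EdgeEv \<epsilon>) = k \<epsilon> * norm (snd f \<epsilon>)"

fun ev_target :: "'h set set \<Rightarrow> 'h set \<Rightarrow> ('h::real_inner) state \<Rightarrow> 'h event \<Rightarrow> 'h state" where
  "ev_target E V0 f (NodeEv x) =
     (fst f, \<lambda>\<epsilon>. if \<epsilon> \<in> E \<and> x \<in> \<epsilon>
                 then snd f \<epsilon> + sgn (fst f x) *\<^sub>R unit_vec (other_end x \<epsilon>) x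
                 else snd f \<epsilon>)"
| "ev_target E V0 f (EdgeEv \<epsilon>) =
     (\<lambda>z. if z \<in> V0 \<and> z \<in> \<epsilon>
          then fst f z + sgn (snd f \<epsilon> \<bullet> unit_vec z (other_end z \<epsilon>))
          else fst f z, snd f)"

definition active ::
  "'h set \<Rightarrow> 'h set set \<Rightarrow> ('h set \<Rightarrow> real) \<Rightarrow> ('h \<Rightarrow> real) \<Rightarrow> 'h set \<Rightarrow> ('h::real_inner) state \<Rightarrow> 'h event set" where
  "active V E k m V0 f =
     {ev \<in> events V E. ev_rate k m f ev \<noteq> 0 \<and> ev_target E V0 f ev \<noteq> f}"

definition total_rate ::
  "'h set \<Rightarrow> 'h set set \<Rightarrow> ('h set \<Rightarrow> real) \<Rightarrow> ('h \<Rightarrow> real) \<Rightarrow> 'h set \<Rightarrow> ('h::real_inner) state \<Rightarrow> real" where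
  "total_rate V E k m V0 f = (\<Sum>ev\<in>active V E k m V0 f. ev_rate k m f ev)"

text \<open>
  Transition probabilities of the (minimal) continuous-time Markov jump process,
  via Feller's backward iteration: trans_n n t f g is the probability to be in g
  at time t having made at most n jumps.
\<close>
fun trans_n ::
  "nat \<Rightarrow> 'h set \<Rightarrow> 'h set set \<Rightarrow> ('h set \<Rightarrow> real) \<Rightarrow> ('h \<Rightarrow> real) \<Rightarrow> 'h set
   \<Rightarrow> real \<Rightarrow> ('h::real_inner) state \<Rightarrow> 'h state \<Rightarrow> real" where
  "trans_n 0 V E k m V0 t f g =
     (if f = g then exp (- total_rate V E k m V0 f * t) else 0)"
| "trans_n (Suc n) V E k m V0 t f g =
     (if f = g then exp (- total_rate V E k m V0 f * t) else 0) +
     integral {0..t} (\<lambda>s. exp (- total_rate V E k m V0 f * s) *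
        (\<Sum>ev\<in>active V E k m V0 f.
            ev_rate k m f ev * trans_n n V E k m V0 (t - s) (ev_target E V0 f ev) g))"

definition trans ::
  "'h set \<Rightarrow> 'h set set \<Rightarrow> ('h set \<Rightarrow> real) \<Rightarrow> ('h \<Rightarrow> real) \<Rightarrow> 'h set
   \<Rightarrow> real \<Rightarrow> ('h::real_inner) state \<Rightarrow> 'h state \<Rightarrow> real" where
  "trans V E k m V0 t f g = (SUP n. trans_n n V E k m V0 t f g)"

definition exp_node ::
  "'h set \<Rightarrow> 'h set set \<Rightarrow> ('h set \<Rightarrow> real) \<Rightarrow> ('h \<Rightarrow> real) \<Rightarrow> 'h set
   \<Rightarrow> ('h::real_inner) state \<Rightarrow> real \<Rightarrow> 'h \<Rightarrow> real" where
  "exp_node V E k m V0 f t x = (\<Sum>\<^sub>\<infinity>g. trans V E k m V0 t f g * fst g x)"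

definition exp_edge ::
  "'h set \<Rightarrow> 'h set set \<Rightarrow> ('h set \<Rightarrow> real) \<Rightarrow> ('h \<Rightarrow> real) \<Rightarrow> 'h set
   \<Rightarrow> ('h::real_inner) state \<Rightarrow> real \<Rightarrow> 'h set \<Rightarrow> 'h" where
  "exp_edge V E k m V0 f t \<epsilon> = (\<Sum>\<^sub>\<infinity>g. trans V E k m V0 t f g *\<^sub>R snd g \<epsilon>)"

end

theory Submission
  imports Defs
begin

text \<open>
  Let \<open>A\<close> be the generator. Expectations restricted to fewer than \<open>n\<close> jumps are finite sums given by
  the backward recursion; uniqueness for a scalar linear equation turns the backward equation into
  the forward one, \<open>u\<^sub>n\<^sub>+\<^sub>1(\<phi>)' = u\<^sub>n(B\<phi>) - u\<^sub>n\<^sub>+\<^sub>1(q\<phi>)\<close>, with \<open>q\<close> the exit rate and \<open>A\<phi> = B\<phi> - q\<phi>\<close>.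
  The total mass grows by a bounded amount per jump and bounds the exit rate linearly, so the square
  of (1 + mass) is a Lyapunov function. It dominates the limit \<open>n \<rightarrow> \<infinity>\<close> and yields
  \<open>E \<phi>(f\<^sub>t) = \<phi>(f) + \<integral>\<^sub>0\<^sup>t E (A\<phi>)(f\<^sub>s) ds\<close> for every \<open>\<phi>\<close> of linear growth.
  For a coordinate \<open>\<phi>\<close>, \<open>A\<phi>\<close> is again a linear combination of coordinates, because rate times sign is
  linear in the state; hence the integrand is continuous and the integral equation can be differentiated.
\<close>

subsection \<open>Scalar linear equations and infinite sums\<close>

lemma integral_reflect_Icc:
  fixes h :: "real \<Rightarrow> real"
  assumes "continuous_on {0..t} h"
  shows "integral {0..t} (\<lambda>s. h (t - s)) = integral {0..t} h"
proof -
  have "(h has_integral integral {0..t} h) (cbox 0 t)"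
    using integrable_continuous_real[OF assms] by (simp add: integrable_integral)
  from has_integral_affinity[OF this, of "-1" t]
  have "((\<lambda>s. h (t - s)) has_integral integral {0..t} h) ((\<lambda>x. t - x) ` {0..t})"
    by (simp add: algebra_simps)
  then show ?thesis
    by (simp add: integral_unique)
qed

text \<open>Variation of constants. In the given form \<open>t\<close> sits both in the limit and in
  the integrand; substituting \<open>t - s\<close> for \<open>s\<close> lets
  \<open>exp (- q * t)\<close> factor out, so that only the upper limit depends on \<open>t\<close>
  and the product rule finishes.\<close>

lemma exp_convolution_deriv:
  fixes b :: "real \<Rightarrow> real" and q a :: real
  assumes b: "continuous_on {0..} b" and t: "t \<ge> 0"
  defines "y \<equiv> \<lambda>t. exp (- q * t) * a + integral {0..t} (\<lambda>s. exp (- q * s) * b (t - s))"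
  shows "(y has_real_derivative (- q * y t + b t)) (at t within {0..})"
proof -
  define I where "I u = integral {0..u} (\<lambda>s. exp (q * s) * b s)" for u
  have y: "y u = exp (- q * u) * (a + I u)" if "u \<ge> 0" for u
  proof -
    have c: "continuous_on {0..u} b"
      by (rule continuous_on_subset[OF b]) auto
    have "integral {0..u} (\<lambda>s. exp (- q * s) * b (u - s))
        = integral {0..u} (\<lambda>s. (\<lambda>v. exp (- q * (u - v)) * b v) (u - s))"
      by simp
    also have "\<dots> = integral {0..u} (\<lambda>v. exp (- q * (u - v)) * b v)"
      by (rule integral_reflect_Icc) (intro continuous_intros c)
    also have "\<dots> = integral {0..u} (\<lambda>v. exp (- q * u) * (exp (q * v) * b v))"
      by (intro integral_cong) (simp add: mult_exp_exp algebra_simps flip: mult.assoc)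
    also have "\<dots> = exp (- q * u) * I u"
      by (simp add: I_def)
    finally show ?thesis
      by (simp add: y_def algebra_simps)
  qed
  have "(I has_real_derivative exp (q * t) * b t) (at t within {0..t+1})"
    unfolding I_def using t
    by (intro integral_has_real_derivative continuous_intros continuous_on_subset[OF b]) auto
  \<comment> \<open>Near \<open>t\<close> the two sets agree. The extra unit keeps \<open>t\<close>
    away from the right end of the compact interval on which the fundamental theorem is
    applied.\<close>
  moreover have "at t within {0..t+1} = at t within {0..}"
    by (rule at_within_nhd[of _ "{..<t+1}"]) auto
  ultimately have "(I has_real_derivative exp (q * t) * b t) (at t within {0..})"
    by simp
  then have "((\<lambda>u. exp (- q * u) * (a + I u)) has_real_derivative
      (- q * (exp (- q * t) * (a + I t)) + b t)) (at t within {0..})"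
    by (auto intro!: derivative_eq_intros simp: algebra_simps exp_minus field_simps)
  then show ?thesis
    using t by (subst has_field_derivative_cong_eventually[where g = "\<lambda>u. exp (- q * u) * (a + I u)"])
       (auto simp: y eventually_at_filter)
qed

text \<open>The integrating factor \<open>exp (q * u)\<close> makes the product constant on the
  half-line, and its value at 0 is 0.\<close>

lemma linear_ode_zero:
  fixes y :: "real \<Rightarrow> real"
  assumes "\<And>t. t \<ge> 0 \<Longrightarrow> (y has_real_derivative - q * y t) (at t within {0..})"
    and "y 0 = 0" "t \<ge> 0"
  shows "y t = 0"
proof -
  have "((\<lambda>u. exp (q * u) * y u) has_real_derivative 0) (at u within {0..})" if "u \<in> {0..}" for u
    using that by (auto intro!: derivative_eq_intros assms(1) simp: algebra_simps)
  then obtain c where "\<And>u. u \<in> {0..} \<Longrightarrow> exp (q * u) * y u = c"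
    using has_field_derivative_zero_constant[of "{0..}" "\<lambda>u. exp (q * u) * y u"] by auto
  from this[of 0] this[of t] show ?thesis
    using assms(2,3) by simp
qed

lemma has_sum_diff:
  fixes f g :: "'a \<Rightarrow> real"
  assumes "(f has_sum a) A" "(g has_sum b) A"
  shows "((\<lambda>x. f x - g x) has_sum (a - b)) A"
  using has_sum_add[OF assms(1) has_sum_uminusI[OF assms(2)]] by simp

lemma has_sum_sum:
  fixes f :: "'i \<Rightarrow> 'a \<Rightarrow> real"
  assumes "finite T" "\<And>i. i \<in> T \<Longrightarrow> (f i has_sum a i) A"
  shows "((\<lambda>x. \<Sum>i\<in>T. f i x) has_sum (\<Sum>i\<in>T. a i)) A"
  using assms by (induction T) (auto intro: has_sum_add)

subsection \<open>Jump processes with a Lyapunov function\<close>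

text \<open>The dynamics is controlled only on \<open>S\<close>; nothing is known about states of
  the type outside it. \<open>L\<close> is a Lyapunov function: rates grow at most linearly in it
  while a jump adds only a bounded amount, which rules out explosion and bounds second
  moments.\<close>

locale jump_process =
  fixes S :: "'a set" and jumps :: "'a \<Rightarrow> 'e set" and rate :: "'a \<Rightarrow> 'e \<Rightarrow> real"
    and dest :: "'a \<Rightarrow> 'e \<Rightarrow> 'a" and L :: "'a \<Rightarrow> real" and M d :: real
  assumes finite_jumps: "g \<in> S \<Longrightarrow> finite (jumps g)"
    and rate_nonneg: "g \<in> S \<Longrightarrow> e \<in> jumps g \<Longrightarrow> rate g e \<ge> 0"
    and dest_closed: "g \<in> S \<Longrightarrow> e \<in> jumps g \<Longrightarrow> dest g e \<in> S"
    and L_ge_1: "g \<in> S \<Longrightarrow> L g \<ge> 1"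
    and rate_le_L: "g \<in> S \<Longrightarrow> (\<Sum>e\<in>jumps g. rate g e) \<le> M * L g"
    and L_dest: "g \<in> S \<Longrightarrow> e \<in> jumps g \<Longrightarrow> L (dest g e) \<le> L g + d"
    and M_nonneg: "M \<ge> 0" and d_nonneg: "d \<ge> 0"
begin

section \<open>Truncated expectations and their backward equation\<close>

definition exit_rate :: "'a \<Rightarrow> real" where
  "exit_rate g = (\<Sum>e\<in>jumps g. rate g e)"

definition jump_op :: "('a \<Rightarrow> real) \<Rightarrow> 'a \<Rightarrow> real" where
  "jump_op \<phi> g = (\<Sum>e\<in>jumps g. rate g e * \<phi> (dest g e))"

text \<open>The expectation of \<open>\<phi>\<close> at time \<open>t\<close> on the event that fewer than \<open>n\<close> jumps have occurred.\<close>

fun trunc_exp :: "nat \<Rightarrow> ('a \<Rightarrow> real) \<Rightarrow> real \<Rightarrow> 'a \<Rightarrow> real" where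
  "trunc_exp 0 \<phi> t g = 0"
| "trunc_exp (Suc n) \<phi> t g = exp (- exit_rate g * t) * \<phi> g +
     integral {0..t} (\<lambda>s. exp (- exit_rate g * s) * jump_op (trunc_exp n \<phi> (t - s)) g)"

lemma exit_rate_nonneg: "g \<in> S \<Longrightarrow> exit_rate g \<ge> 0"
  unfolding exit_rate_def by (intro sum_nonneg rate_nonneg)

lemma jump_op_cong:
  assumes "\<And>g. g \<in> S \<Longrightarrow> \<phi> g = \<psi> g" "g \<in> S"
  shows "jump_op \<phi> g = jump_op \<psi> g"
  unfolding jump_op_def using assms by (intro sum.cong) (auto simp: dest_closed)

lemma jump_op_mono:
  assumes "\<And>g. g \<in> S \<Longrightarrow> \<phi> g \<le> \<psi> g" "g \<in> S"
  shows "jump_op \<phi> g \<le> jump_op \<psi> g"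
  unfolding jump_op_def using assms
  by (auto intro!: sum_mono mult_left_mono dest_closed rate_nonneg)

lemma jump_op_linear: "jump_op (\<lambda>g. a * \<phi> g + b * \<psi> g) g = a * jump_op \<phi> g + b * jump_op \<psi> g"
  by (simp add: jump_op_def sum.distrib sum_distrib_left algebra_simps)

lemma jump_op_cmult: "jump_op (\<lambda>g. a * \<phi> g) g = a * jump_op \<phi> g"
  using jump_op_linear[of a \<phi> 0 \<phi>] by simp

lemma jump_op_const: "jump_op (\<lambda>_. c) g = exit_rate g * c"
  by (simp add: jump_op_def exit_rate_def sum_distrib_right)

lemma jump_op_deriv:
  assumes "\<And>g. g \<in> S \<Longrightarrow> ((\<lambda>s. u s g) has_real_derivative v g) (at t within T)" "g \<in> S"
  shows "((\<lambda>s. jump_op (u s) g) has_real_derivative jump_op v g) (at t within T)"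
  unfolding jump_op_def by (intro DERIV_sum DERIV_cmult assms(1) dest_closed assms(2))

lemma jump_op_continuous:
  assumes "\<And>g. g \<in> S \<Longrightarrow> continuous_on T (\<lambda>s. u s g)" "g \<in> S"
  shows "continuous_on T (\<lambda>s. jump_op (u s) g)"
  unfolding jump_op_def using assms by (auto intro!: continuous_intros dest_closed)

lemma trunc_exp_continuous: "g \<in> S \<Longrightarrow> continuous_on {0..} (\<lambda>t. trunc_exp n \<phi> t g)"
proof (induction n arbitrary: g)
  case (Suc n)
  have "continuous_on {0..} (\<lambda>t. jump_op (trunc_exp n \<phi> t) g)"
    by (rule jump_op_continuous) (use Suc in auto)
  \<comment> \<open>Continuity at level \<open>n\<close> makes level \<open>n + 1\<close>
    differentiable, hence continuous.\<close>
  from exp_convolution_deriv[OF this] show ?case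
    unfolding continuous_on_eq_continuous_within trunc_exp.simps
    by (blast intro: DERIV_continuous)
qed simp

lemma trunc_exp_backward:
  assumes "g \<in> S" "t \<ge> 0"
  shows "((\<lambda>t. trunc_exp (Suc n) \<phi> t g) has_real_derivative
     (- exit_rate g * trunc_exp (Suc n) \<phi> t g + jump_op (trunc_exp n \<phi> t) g)) (at t within {0..})"
proof -
  have "continuous_on {0..} (\<lambda>t. jump_op (trunc_exp n \<phi> t) g)"
    by (rule jump_op_continuous) (use assms trunc_exp_continuous in auto)
  from exp_convolution_deriv[OF this assms(2)] show ?thesis
    by simp
qed

section \<open>The forward equation for truncated expectations\<close>

lemma trunc_exp_time_0: "trunc_exp n \<phi> 0 g = (if n = 0 then 0 else \<phi> g)"
  by (cases n) auto

text \<open>Both sides solve the same linear equation with decay rate \<open>exit_rate g\<close>, by the backward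
  equation and the induction hypothesis, and they agree at time 0.\<close>

lemma trunc_exp_forward_eq:
  assumes "g \<in> S" "t \<ge> 0"
  shows "- exit_rate g * trunc_exp (Suc n) \<phi> t g + jump_op (trunc_exp n \<phi> t) g =
     trunc_exp n (jump_op \<phi>) t g - trunc_exp (Suc n) (\<lambda>h. exit_rate h * \<phi> h) t g"
  using assms
proof (induction n arbitrary: g t)
  case 0
  then show ?case
    by (simp add: jump_op_def)
next
  case (Suc n)
  define q\<phi> where "q\<phi> = (\<lambda>h. exit_rate h * \<phi> h)"
  \<comment> \<open>\<open>R\<close> is the inhomogeneity shared by \<open>z\<close> and
    \<open>w\<close>. For \<open>z\<close> it is the derivative of the jump term, rewritten by the
    induction hypothesis at the neighbouring states; for \<open>w\<close> it is the difference of
    two backward equations, by linearity of \<open>jump_op\<close>.\<close>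
  define R where "R s = jump_op (\<lambda>h. trunc_exp n (jump_op \<phi>) s h - trunc_exp (Suc n) q\<phi> s h) g" for s
  define z where "z = (\<lambda>s. - exit_rate g * trunc_exp (Suc (Suc n)) \<phi> s g + jump_op (trunc_exp (Suc n) \<phi> s) g)"
  define w where "w = (\<lambda>s. trunc_exp (Suc n) (jump_op \<phi>) s g - trunc_exp (Suc (Suc n)) q\<phi> s g)"
  have dz: "(z has_real_derivative - exit_rate g * z s + R s) (at s within {0..})" if s: "s \<ge> 0" for s
  proof -
    have "((\<lambda>s. trunc_exp (Suc n) \<phi> s h) has_real_derivative
        (trunc_exp n (jump_op \<phi>) s h - trunc_exp (Suc n) q\<phi> s h)) (at s within {0..})" if "h \<in> S" for h
      using trunc_exp_backward[OF that s, of n \<phi>] Suc.IH[OF that s] by (simp only: q\<phi>_def)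
    from jump_op_deriv[OF this Suc.prems(1)]
    have "((\<lambda>s. jump_op (trunc_exp (Suc n) \<phi> s) g) has_real_derivative R s) (at s within {0..})"
      by (simp only: R_def)
    from DERIV_add[OF DERIV_cmult[OF trunc_exp_backward[OF Suc.prems(1) s, of "Suc n" \<phi>], of "- exit_rate g"] this]
    show ?thesis
      by (simp only: z_def)
  qed
  have R: "R s = jump_op (trunc_exp n (jump_op \<phi>) s) g - jump_op (trunc_exp (Suc n) q\<phi> s) g" for s
    unfolding R_def
    using jump_op_linear[of 1 "trunc_exp n (jump_op \<phi>) s" "-1" "trunc_exp (Suc n) q\<phi> s"]
    by (simp del: trunc_exp.simps)
  have dw: "(w has_real_derivative - exit_rate g * w s + R s) (at s within {0..})" if s: "s \<ge> 0" for s
    using DERIV_diff[OF trunc_exp_backward[OF Suc.prems(1) s, of n "jump_op \<phi>"]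
        trunc_exp_backward[OF Suc.prems(1) s, of "Suc n" q\<phi>]]
    unfolding w_def R by (simp only: algebra_simps)
  have "z t - w t = 0"
  proof (rule linear_ode_zero[where q = "exit_rate g" and y = "\<lambda>s. z s - w s"])
    show "((\<lambda>s. z s - w s) has_real_derivative - exit_rate g * (z s - w s)) (at s within {0..})"
      if "s \<ge> 0" for s
      using DERIV_diff[OF dz[OF that] dw[OF that]] by (simp add: algebra_simps)
    \<comment> \<open>At time 0 all truncations involved have positive index and return the test
      function itself, so both sides equal
      \<open>jump_op \<phi> g - exit_rate g * \<phi> g\<close>.\<close>
    show "z 0 - w 0 = 0"
      unfolding z_def w_def q\<phi>_def trunc_exp_time_0 jump_op_def by (simp add: trunc_exp_time_0 del: trunc_exp.simps)
  qed (use Suc.prems in auto)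
  then show ?case
    by (simp only: z_def w_def q\<phi>_def right_minus_eq)
qed

text \<open>The integrated forward equation. The indices differ because a state entered with fewer
  than \<open>n + 1\<close> jumps was left with fewer than \<open>n\<close>, whereas the loss term
  concerns the states already counted at level \<open>n + 1\<close>.\<close>

lemma trunc_exp_forward:
  assumes "g \<in> S" "t \<ge> 0"
  shows "((\<lambda>s. trunc_exp n (jump_op \<phi>) s g - trunc_exp (Suc n) (\<lambda>h. exit_rate h * \<phi> h) s g)
    has_integral (trunc_exp (Suc n) \<phi> t g - \<phi> g)) {0..t}"
proof -
  have "((\<lambda>s. trunc_exp (Suc n) \<phi> s g) has_vector_derivative
      (trunc_exp n (jump_op \<phi>) s g - trunc_exp (Suc n) (\<lambda>h. exit_rate h * \<phi> h) s g)) (at s within {0..t})"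
    if "s \<in> {0..t}" for s
    using trunc_exp_backward[OF assms(1), of s n \<phi>] trunc_exp_forward_eq[OF assms(1), of s n \<phi>] that
    unfolding has_real_derivative_iff_has_vector_derivative[symmetric]
    by (auto intro: DERIV_subset simp del: trunc_exp.simps)
  from fundamental_theorem_of_calculus[OF assms(2) this] show ?thesis
    by (simp only: trunc_exp_time_0 nat.distinct if_False)
qed

section \<open>Linearity, monotonicity and growth of truncated expectations\<close>

lemma integrand_continuous:
  assumes "g \<in> S"
  shows "continuous_on {0..t} (\<lambda>s. exp (- exit_rate g * s) * jump_op (trunc_exp n \<phi> (t - s)) g)"
proof (intro continuous_intros jump_op_continuous assms)
  fix h assume h: "h \<in> S"
  show "continuous_on {0..t} (\<lambda>s. trunc_exp n \<phi> (t - s) h)"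
    by (rule continuous_on_compose2[OF trunc_exp_continuous[OF h, of n \<phi>]]) (auto intro!: continuous_intros)
qed

lemmas integrand_integrable = integrable_continuous_real[OF integrand_continuous]

lemma trunc_exp_linear:
  assumes "g \<in> S" "t \<ge> 0"
  shows "trunc_exp n (\<lambda>h. a * \<phi> h + b * \<psi> h) t g = a * trunc_exp n \<phi> t g + b * trunc_exp n \<psi> t g"
  using assms
proof (induction n arbitrary: g t)
  case (Suc n)
  have "integral {0..t} (\<lambda>s. exp (- exit_rate g * s) * jump_op (trunc_exp n (\<lambda>h. a * \<phi> h + b * \<psi> h) (t - s)) g)
    = integral {0..t} (\<lambda>s. a * (exp (- exit_rate g * s) * jump_op (trunc_exp n \<phi> (t - s)) g)
      + b * (exp (- exit_rate g * s) * jump_op (trunc_exp n \<psi> (t - s)) g))"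
  proof (rule integral_cong)
    fix s assume s: "s \<in> {0..t}"
    have "jump_op (trunc_exp n (\<lambda>h. a * \<phi> h + b * \<psi> h) (t - s)) g
      = jump_op (\<lambda>h. a * trunc_exp n \<phi> (t - s) h + b * trunc_exp n \<psi> (t - s) h) g"
      by (rule jump_op_cong) (use Suc s in auto)
    then show "exp (- exit_rate g * s) * jump_op (trunc_exp n (\<lambda>h. a * \<phi> h + b * \<psi> h) (t - s)) g
      = a * (exp (- exit_rate g * s) * jump_op (trunc_exp n \<phi> (t - s)) g)
      + b * (exp (- exit_rate g * s) * jump_op (trunc_exp n \<psi> (t - s)) g)"
      by (simp add: jump_op_linear algebra_simps)
  qed
  also have "\<dots> = a * integral {0..t} (\<lambda>s. exp (- exit_rate g * s) * jump_op (trunc_exp n \<phi> (t - s)) g)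
      + b * integral {0..t} (\<lambda>s. exp (- exit_rate g * s) * jump_op (trunc_exp n \<psi> (t - s)) g)"
    by (subst integral_add)
       (intro integrable_on_mult_right integrand_integrable Suc.prems integral_mult_right | simp only: integral_mult_right)+
  finally show ?case
    by (simp add: algebra_simps)
qed simp

lemma trunc_exp_mono:
  assumes "\<And>h. h \<in> S \<Longrightarrow> \<phi> h \<le> \<psi> h" "g \<in> S" "t \<ge> 0"
  shows "trunc_exp n \<phi> t g \<le> trunc_exp n \<psi> t g"
  using assms(2,3)
proof (induction n arbitrary: g t)
  case (Suc n)
  then show ?case
    unfolding trunc_exp.simps
    by (intro add_mono mult_left_mono integral_le integrand_integrable jump_op_mono assms) auto
qed simp

lemma trunc_exp_cong:
  assumes "\<And>h. h \<in> S \<Longrightarrow> \<phi> h = \<psi> h" "g \<in> S" "t \<ge> 0"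
  shows "trunc_exp n \<phi> t g = trunc_exp n \<psi> t g"
  using assms by (intro antisym trunc_exp_mono) auto

lemma trunc_exp_zero: "g \<in> S \<Longrightarrow> t \<ge> 0 \<Longrightarrow> trunc_exp n (\<lambda>_. 0) t g = 0"
  using trunc_exp_linear[of g t n 0 "\<lambda>_. 0" 0 "\<lambda>_. 0"] by simp

lemma trunc_exp_cmult: "g \<in> S \<Longrightarrow> t \<ge> 0 \<Longrightarrow> trunc_exp n (\<lambda>h. a * \<phi> h) t g = a * trunc_exp n \<phi> t g"
  using trunc_exp_linear[of g t n a \<phi> 0 \<phi>] by simp

lemma trunc_exp_nonneg:
  assumes "\<And>h. h \<in> S \<Longrightarrow> 0 \<le> \<phi> h" "g \<in> S" "t \<ge> 0"
  shows "0 \<le> trunc_exp n \<phi> t g"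
  using trunc_exp_mono[of "\<lambda>_. 0" \<phi> g t n] assms by (simp add: trunc_exp_zero)

text \<open>Admitting one more jump can only add a nonnegative contribution. The induction starts
  from \<open>trunc_exp 0\<close>, which is 0, and is carried on by monotonicity of
  \<open>jump_op\<close>.\<close>

lemma trunc_exp_Suc_mono:
  assumes "\<And>h. h \<in> S \<Longrightarrow> 0 \<le> \<phi> h" "g \<in> S" "t \<ge> 0"
  shows "trunc_exp n \<phi> t g \<le> trunc_exp (Suc n) \<phi> t g"
  using assms(2,3)
proof (induction n arbitrary: g t)
  case 0
  then show ?case
    using trunc_exp_nonneg[of \<phi> g t "Suc 0"] assms(1) by (simp only: trunc_exp.simps(1))
next
  case (Suc n)
  have "integral {0..t} (\<lambda>s. exp (- exit_rate g * s) * jump_op (trunc_exp n \<phi> (t - s)) g)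
    \<le> integral {0..t} (\<lambda>s. exp (- exit_rate g * s) * jump_op (trunc_exp (Suc n) \<phi> (t - s)) g)"
  proof (intro integral_le integrand_integrable Suc.prems mult_left_mono jump_op_mono)
    show "trunc_exp n \<phi> (t - s) h \<le> trunc_exp (Suc n) \<phi> (t - s) h" if "s \<in> {0..t}" "h \<in> S" for s h
      by (rule Suc.IH) (use that in auto)
  qed (rule exp_ge_zero)
  then show ?case
    by (simp only: trunc_exp.simps(2)[of "Suc n"] trunc_exp.simps(2)[of n \<phi> t g] add_le_cancel_left)
qed

lemma incseq_trunc_exp:
  assumes "\<And>h. h \<in> S \<Longrightarrow> 0 \<le> \<phi> h" "g \<in> S" "t \<ge> 0"
  shows "incseq (\<lambda>n. trunc_exp n \<phi> t g)"
  by (rule incseq_SucI) (use trunc_exp_Suc_mono[of \<phi>] assms in blast)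

text \<open>The second hypothesis says that the generator sends \<open>W\<close> below
  \<open>C * W\<close>. The resulting exponential bound is uniform in \<open>n\<close>, since the
  recursion reproduces the majorant \<open>exp (C * t) * W g\<close>.\<close>

lemma trunc_exp_bound:
  assumes W: "\<And>h. h \<in> S \<Longrightarrow> W h \<ge> 0" "\<And>h. h \<in> S \<Longrightarrow> jump_op W h \<le> (C + exit_rate h) * W h"
    and "g \<in> S" "t \<ge> 0"
  shows "trunc_exp n W t g \<le> exp (C * t) * W g"
  using assms(3,4)
proof (induction n arbitrary: g t)
  case 0
  then show ?case
    using W(1) by simp
next
  case (Suc n)
  let ?q = "exit_rate g"
  \<comment> \<open>After the induction hypothesis the integrand is an exact derivative. Its
    integral is \<open>exp (C * t) * W g - exp (- ?q * t) * W g\<close>, and the subtracted term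
    cancels the no-jump term of the recursion.\<close>
  have I: "((\<lambda>s. exp (- ?q * s) * (exp (C * (t - s)) * ((C + ?q) * W g))) has_integral
      (- exp (- ?q * t) * exp (C * (t - t)) * W g - - exp (- ?q * 0) * exp (C * (t - 0)) * W g)) {0..t}"
  proof (rule fundamental_theorem_of_calculus[OF Suc.prems(2)])
    show "((\<lambda>s. - exp (- ?q * s) * exp (C * (t - s)) * W g) has_vector_derivative
        exp (- ?q * s) * (exp (C * (t - s)) * ((C + ?q) * W g))) (at s within {0..t})" for s
      unfolding has_real_derivative_iff_has_vector_derivative[symmetric]
      by (rule derivative_eq_intros refl)+ (simp add: algebra_simps)
  qed
  have "integral {0..t} (\<lambda>s. exp (- ?q * s) * jump_op (trunc_exp n W (t - s)) g)
    \<le> integral {0..t} (\<lambda>s. exp (- ?q * s) * (exp (C * (t - s)) * ((C + ?q) * W g)))"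
  proof (rule integral_le)
    fix s assume s: "s \<in> {0..t}"
    have "jump_op (trunc_exp n W (t - s)) g \<le> jump_op (\<lambda>h. exp (C * (t - s)) * W h) g"
      by (rule jump_op_mono) (use Suc s in auto)
    also have "\<dots> \<le> exp (C * (t - s)) * ((C + ?q) * W g)"
      unfolding jump_op_cmult by (intro mult_left_mono W Suc.prems) auto
    finally show "exp (- ?q * s) * jump_op (trunc_exp n W (t - s)) g
        \<le> exp (- ?q * s) * (exp (C * (t - s)) * ((C + ?q) * W g))"
      by (intro mult_left_mono) auto
  qed (intro integrand_integrable Suc.prems has_integral_integrable[OF I])+
  also have "\<dots> = exp (C * t) * W g - exp (- ?q * t) * W g"
    using integral_unique[OF I] by simp
  finally show ?case
    by simp
qed

section \<open>Finite sums over reachable states and transition probabilities\<close>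

fun reach :: "nat \<Rightarrow> 'a \<Rightarrow> 'a set" where
  "reach 0 g = {}"
| "reach (Suc n) g = insert g (\<Union>e\<in>jumps g. reach n (dest g e))"

lemma finite_reach: "g \<in> S \<Longrightarrow> finite (reach n g)"
  by (induction n arbitrary: g) (auto simp: finite_jumps dest_closed)

text \<open>Unfolding the recursion evaluates the test function only at states visited with fewer
  than \<open>n\<close> jumps, and \<open>reach n g\<close> collects these. As this set is finite
  for \<open>g\<close> in \<open>S\<close>, infinite sums enter only in the limit.\<close>

lemma trunc_exp_local:
  assumes "\<And>h. h \<in> reach n g \<Longrightarrow> \<phi> h = \<psi> h"
  shows "trunc_exp n \<phi> t g = trunc_exp n \<psi> t g"
  using assms
proof (induction n arbitrary: g t)
  case (Suc n)
  have "jump_op (trunc_exp n \<phi> s) g = jump_op (trunc_exp n \<psi> s) g" for s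
    unfolding jump_op_def by (intro sum.cong refl arg_cong2[of _ _ _ _ times] Suc.IH) (use Suc.prems in auto)
  then show ?case
    using Suc.prems by simp
qed simp

lemma trunc_exp_sum:
  assumes "finite T" "g \<in> S" "t \<ge> 0"
  shows "trunc_exp n (\<lambda>h. \<Sum>i\<in>T. c i * \<phi> i h) t g = (\<Sum>i\<in>T. c i * trunc_exp n (\<phi> i) t g)"
  using assms(1)
proof (induction T)
  case empty
  then show ?case
    using assms by (simp add: trunc_exp_zero)
next
  case (insert i T)
  then show ?case
    using trunc_exp_linear[OF assms(2,3), of n "c i" "\<phi> i" 1 "\<lambda>h. \<Sum>i\<in>T. c i * \<phi> i h"] by simp
qed

definition point :: "'a \<Rightarrow> 'a \<Rightarrow> real" where
  "point g h = (if h = g then 1 else 0)"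

text \<open>On the reachable set the test function is a finite combination of point indicators, so
  locality and linearity apply. \<open>T\<close> may exceed \<open>reach n g\<close>, which permits
  comparison with arbitrary finite partial sums.\<close>

lemma trunc_exp_eq_sum:
  assumes "finite T" "reach n g \<subseteq> T" "g \<in> S" "t \<ge> 0"
  shows "trunc_exp n \<phi> t g = (\<Sum>h\<in>T. trunc_exp n (point h) t g * \<phi> h)"
proof -
  have "trunc_exp n \<phi> t g = trunc_exp n (\<lambda>h. \<Sum>i\<in>T. \<phi> i * point i h) t g"
    by (rule trunc_exp_local)
       (use assms in \<open>auto simp: point_def if_distrib[of "(*) _"] sum.delta' cong: if_cong\<close>)
  then show ?thesis
    using assms by (simp add: trunc_exp_sum mult.commute)
qed

text \<open>The index is shifted because \<open>trunc_exp n\<close> counts fewer than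
  \<open>n\<close> jumps while \<open>trans_n n\<close> counts at most \<open>n\<close>.\<close>

definition tprob :: "real \<Rightarrow> 'a \<Rightarrow> 'a \<Rightarrow> real" where
  "tprob t g h = (SUP n. trunc_exp (Suc n) (point h) t g)"

lemma point_nonneg: "0 \<le> point h i"
  by (simp add: point_def)

text \<open>The generator annihilates the constant 1, so \<open>trunc_exp_bound\<close> with
  \<open>C = 0\<close> bounds the total probability by 1.\<close>

lemma trunc_exp_point_le_1:
  assumes "g \<in> S" "t \<ge> 0"
  shows "trunc_exp n (point h) t g \<le> 1"
proof -
  have "trunc_exp n (point h) t g \<le> trunc_exp n (\<lambda>_. 1) t g"
    by (rule trunc_exp_mono) (use assms in \<open>auto simp: point_def\<close>)
  also have "\<dots> \<le> exp (0 * t) * 1"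
    by (rule trunc_exp_bound) (use assms in \<open>auto simp: jump_op_const\<close>)
  finally show ?thesis by simp
qed

lemma tprob_lim:
  assumes "g \<in> S" "t \<ge> 0"
  shows "(\<lambda>n. trunc_exp n (point h) t g) \<longlonglongrightarrow> tprob t g h"
proof -
  have "(\<lambda>n. trunc_exp (Suc n) (point h) t g) \<longlonglongrightarrow> tprob t g h"
    unfolding tprob_def
  proof (rule LIMSEQ_incseq_SUP)
    show "bdd_above (range (\<lambda>n. trunc_exp (Suc n) (point h) t g))"
      using trunc_exp_point_le_1[OF assms] by (intro bdd_aboveI2)
    show "incseq (\<lambda>n. trunc_exp (Suc n) (point h) t g)"
      by (intro incseq_SucI trunc_exp_Suc_mono point_nonneg assms)
  qed
  then show ?thesis
    by (rule LIMSEQ_imp_Suc)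
qed

lemma trunc_exp_le_tprob:
  assumes "g \<in> S" "t \<ge> 0"
  shows "trunc_exp n (point h) t g \<le> tprob t g h"
  by (rule incseq_le[OF incseq_trunc_exp tprob_lim]) (use assms point_nonneg in auto)

lemma tprob_nonneg:
  assumes "g \<in> S" "t \<ge> 0"
  shows "0 \<le> tprob t g h"
  using trunc_exp_le_tprob[OF assms, of 0] by simp

text \<open>Truncated expectations see a test function only through its values on \<open>S\<close>.
  Consequently sums over the whole type, as in \<open>expect\<close>, carry no weight outside
  \<open>S\<close>.\<close>

lemma trunc_exp_point_outside:
  assumes "g \<in> S" "t \<ge> 0" "h \<notin> S"
  shows "trunc_exp n (point h) t g = 0"
proof -
  have "trunc_exp n (point h) t g = trunc_exp n (\<lambda>_. 0) t g"
    by (rule trunc_exp_cong) (use assms in \<open>auto simp: point_def\<close>)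
  then show ?thesis
    using assms by (simp add: trunc_exp_zero)
qed

lemma tprob_outside:
  assumes "g \<in> S" "t \<ge> 0" "h \<notin> S"
  shows "tprob t g h = 0"
  using assms by (simp add: tprob_def trunc_exp_point_outside del: trunc_exp.simps)

section \<open>The quadratic Lyapunov bound\<close>

definition growth :: real where
  "growth = M * (2 * d + d\<^sup>2)"

lemma exit_rate_le: "g \<in> S \<Longrightarrow> exit_rate g \<le> M * L g"
  unfolding exit_rate_def by (rule rate_le_L)

text \<open>A jump raises the square of \<open>L\<close> by at most
  \<open>2 * d * L g + d\<^sup>2\<close>, and jumps occur at total rate at most
  \<open>M * L g\<close>; this is the origin of \<open>growth\<close>.\<close>

lemma jump_op_L2:
  assumes "g \<in> S"
  shows "jump_op (\<lambda>h. (L h)\<^sup>2) g \<le> (growth + exit_rate g) * (L g)\<^sup>2"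
proof -
  have L: "L g \<ge> 1"
    by (rule L_ge_1[OF assms])
  have "jump_op (\<lambda>h. (L h)\<^sup>2) g \<le> (\<Sum>e\<in>jumps g. rate g e * (L g + d)\<^sup>2)"
    unfolding jump_op_def
  proof (intro sum_mono mult_left_mono power_mono)
    fix e assume e: "e \<in> jumps g"
    show "0 \<le> L (dest g e)"
      using L_ge_1[OF dest_closed[OF assms e]] by simp
  qed (use assms rate_nonneg L_dest in auto)
  also have "\<dots> = exit_rate g * (L g)\<^sup>2 + exit_rate g * (2 * d * L g + d\<^sup>2)"
    unfolding exit_rate_def sum_distrib_right[symmetric] by (simp add: power2_eq_square algebra_simps)
  \<comment> \<open>Here \<open>L g \<ge> 1\<close> absorbs the constant \<open>d\<^sup>2\<close>
    into a multiple of \<open>L g\<close>, so that the bound becomes homogeneous of degree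
    2.\<close>
  also have "exit_rate g * (2 * d * L g + d\<^sup>2) \<le> (M * L g) * (2 * d * L g + d\<^sup>2 * L g)"
  proof (intro mult_mono exit_rate_le assms add_left_mono)
    show "d\<^sup>2 \<le> d\<^sup>2 * L g"
      using mult_left_mono[OF L, of "d\<^sup>2"] by simp
  qed (use L M_nonneg d_nonneg in auto)
  finally show ?thesis
    by (simp add: growth_def power2_eq_square algebra_simps)
qed

lemma trunc_exp_L2:
  "g \<in> S \<Longrightarrow> t \<ge> 0 \<Longrightarrow> trunc_exp n (\<lambda>h. (L h)\<^sup>2) t g \<le> exp (growth * t) * (L g)\<^sup>2"
  by (rule trunc_exp_bound) (auto intro: jump_op_L2)

lemma trunc_exp_abs_le:
  assumes "\<And>h. h \<in> S \<Longrightarrow> \<bar>\<phi> h\<bar> \<le> c * (L h)\<^sup>2" "g \<in> S" "t \<ge> 0"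
  shows "\<bar>trunc_exp n \<phi> t g\<bar> \<le> c * (exp (growth * t) * (L g)\<^sup>2)"
proof -
  \<comment> \<open>The sign of \<open>c\<close> is read off from the bound at \<open>g\<close>
    itself, where \<open>L g\<close> is positive.\<close>
  have "0 \<le> c * (L g)\<^sup>2" "(L g)\<^sup>2 > 0"
    using assms(1)[OF assms(2)] L_ge_1[OF assms(2)] by (auto intro: order_trans[OF abs_ge_zero])
  then have c: "c \<ge> 0"
    by (simp add: zero_le_mult_iff)
  have u: "trunc_exp n \<psi> t g \<le> c * (exp (growth * t) * (L g)\<^sup>2)"
    if "\<And>h. h \<in> S \<Longrightarrow> \<psi> h \<le> c * (L h)\<^sup>2" for \<psi>
  proof -
    have "trunc_exp n \<psi> t g \<le> trunc_exp n (\<lambda>h. c * (L h)\<^sup>2) t g"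
      by (intro trunc_exp_mono that assms)
    also have "\<dots> = c * trunc_exp n (\<lambda>h. (L h)\<^sup>2) t g"
      by (intro trunc_exp_cmult assms)
    finally show ?thesis
      using mult_left_mono[OF trunc_exp_L2[OF assms(2,3)] c] by (rule order_trans)
  qed
  have "trunc_exp n \<phi> t g \<le> c * (exp (growth * t) * (L g)\<^sup>2)"
    by (rule u) (use assms(1) abs_le_D1 in blast)
  moreover have "trunc_exp n (\<lambda>h. - 1 * \<phi> h) t g \<le> c * (exp (growth * t) * (L g)\<^sup>2)"
    by (rule u) (use assms(1) abs_le_D2 in fastforce)
  ultimately show ?thesis
    unfolding trunc_exp_cmult[OF assms(2,3)] by simp
qed

section \<open>Expectations as limits of truncated expectations\<close>

definition expect :: "('a \<Rightarrow> real) \<Rightarrow> real \<Rightarrow> 'a \<Rightarrow> real" where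
  "expect \<phi> t g = (\<Sum>\<^sub>\<infinity>h. tprob t g h * \<phi> h)"

text \<open>Monotone convergence by hand. The increasing truncated expectations are bounded through
  the Lyapunov estimate and tend to some \<open>l\<close>; finite partial sums of the series and
  truncated expectations then bound each other, which identifies \<open>l\<close> with the
  sum.\<close>

lemma expect_lim_nonneg:
  assumes \<phi>: "\<And>h. h \<in> S \<Longrightarrow> 0 \<le> \<phi> h" "\<And>h. h \<in> S \<Longrightarrow> \<phi> h \<le> c * (L h)\<^sup>2"
    and g: "g \<in> S" "t \<ge> 0"
  shows "(\<lambda>h. tprob t g h * \<phi> h) summable_on UNIV"
    and "(\<lambda>n. trunc_exp n \<phi> t g) \<longlonglongrightarrow> expect \<phi> t g"
proof -
  have "trunc_exp n \<phi> t g \<le> c * (exp (growth * t) * (L g)\<^sup>2)" for n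
    using trunc_exp_abs_le[of \<phi> c g t n] \<phi> g by fastforce
  then have "bdd_above (range (\<lambda>n. trunc_exp n \<phi> t g))"
    by (rule bdd_aboveI2)
  from LIMSEQ_incseq_SUP[OF this incseq_trunc_exp]
  obtain l where l: "(\<lambda>n. trunc_exp n \<phi> t g) \<longlonglongrightarrow> l"
    using \<phi>(1) g by blast
  \<comment> \<open>Outside \<open>S\<close> the sign of \<open>\<phi>\<close> is unknown, but there
    the weight is 0.\<close>
  have nonneg: "0 \<le> trunc_exp n (point h) t g * \<phi> h" for n h
    using trunc_exp_point_outside[OF g, of h n] \<phi>(1)[of h] trunc_exp_nonneg[of "point h", OF point_nonneg g, of n]
    by (cases "h \<in> S") auto
  have nonneg': "0 \<le> tprob t g h * \<phi> h" for h
    using tprob_outside[OF g, of h] \<phi>(1)[of h] tprob_nonneg[OF g, of h]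
    by (cases "h \<in> S") auto
  have le: "trunc_exp n (point h) t g * \<phi> h \<le> tprob t g h * \<phi> h" for n h
    using trunc_exp_point_outside[OF g, of h n] tprob_outside[OF g, of h]
      mult_right_mono[OF trunc_exp_le_tprob[OF g, of n h] \<phi>(1)[of h]]
    by (cases "h \<in> S") auto
  have fin: "(\<Sum>h\<in>T. tprob t g h * \<phi> h) \<le> l" if T: "finite T" for T
  proof (rule LIMSEQ_le)
    show "(\<lambda>n. \<Sum>h\<in>T. trunc_exp n (point h) t g * \<phi> h) \<longlonglongrightarrow> (\<Sum>h\<in>T. tprob t g h * \<phi> h)"
      by (intro tendsto_intros tprob_lim g)
    \<comment> \<open>Enlarging \<open>T\<close> by \<open>reach n g\<close> only adds nonnegative
      terms and turns the partial sum into the full truncated expectation.\<close>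
    have "(\<Sum>h\<in>T. trunc_exp n (point h) t g * \<phi> h) \<le> trunc_exp n \<phi> t g" for n
    proof -
      have "(\<Sum>h\<in>T. trunc_exp n (point h) t g * \<phi> h)
          \<le> (\<Sum>h\<in>T \<union> reach n g. trunc_exp n (point h) t g * \<phi> h)"
        by (rule sum_mono2) (use T finite_reach[OF g(1)] nonneg in auto)
      also have "\<dots> = trunc_exp n \<phi> t g"
        by (rule trunc_exp_eq_sum[symmetric]) (use T finite_reach[OF g(1)] g in auto)
      finally show ?thesis .
    qed
    then show "\<exists>N. \<forall>n\<ge>N. (\<Sum>h\<in>T. trunc_exp n (point h) t g * \<phi> h) \<le> trunc_exp n \<phi> t g"
      by blast
  qed (rule l)
  show s: "(\<lambda>h. tprob t g h * \<phi> h) summable_on UNIV"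
    by (rule nonneg_bdd_above_summable_on) (use nonneg' fin in \<open>auto intro!: bdd_aboveI2\<close>)
  have "trunc_exp n \<phi> t g \<le> expect \<phi> t g" for n
  proof -
    have "trunc_exp n \<phi> t g = (\<Sum>h\<in>reach n g. trunc_exp n (point h) t g * \<phi> h)"
      by (rule trunc_exp_eq_sum) (use finite_reach[OF g(1)] g in auto)
    also have "\<dots> \<le> (\<Sum>h\<in>reach n g. tprob t g h * \<phi> h)"
      by (intro sum_mono le)
    also have "\<dots> \<le> expect \<phi> t g"
      unfolding expect_def
      by (rule finite_sum_le_infsum) (use s nonneg' finite_reach[OF g(1)] in auto)
    finally show ?thesis .
  qed
  then have "l \<le> expect \<phi> t g"
    using l by (intro LIMSEQ_le_const2) auto
  moreover have "expect \<phi> t g \<le> l"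
    unfolding expect_def using s fin by (intro infsum_le_finite_sums) auto
  ultimately show "(\<lambda>n. trunc_exp n \<phi> t g) \<longlonglongrightarrow> expect \<phi> t g"
    using l by simp
qed

text \<open>A signed function is split as \<open>\<psi> - W\<close>, where \<open>W\<close> is the
  dominating multiple of the squared Lyapunov function; both parts are nonnegative on
  \<open>S\<close> and fall under the previous lemma.\<close>

lemma expect_lim:
  assumes \<phi>: "\<And>h. h \<in> S \<Longrightarrow> \<bar>\<phi> h\<bar> \<le> c * (L h)\<^sup>2"
    and g: "g \<in> S" "t \<ge> 0"
  shows "(\<lambda>h. tprob t g h * \<phi> h) summable_on UNIV"
    and "(\<lambda>n. trunc_exp n \<phi> t g) \<longlonglongrightarrow> expect \<phi> t g"
proof -
  define W where "W h = c * (L h)\<^sup>2" for h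
  define \<psi> where "\<psi> h = \<phi> h + W h" for h
  have W: "0 \<le> W h" "W h \<le> c * (L h)\<^sup>2" "0 \<le> \<psi> h" "\<psi> h \<le> 2 * c * (L h)\<^sup>2" if "h \<in> S" for h
    using \<phi>[OF that] by (auto simp: W_def \<psi>_def abs_le_iff)
  note lW = expect_lim_nonneg[of W, OF W(1,2) g] and l\<psi> = expect_lim_nonneg[of \<psi>, OF W(3,4) g]
  have eq: "tprob t g h * \<phi> h = tprob t g h * \<psi> h - tprob t g h * W h" for h
    by (simp add: \<psi>_def algebra_simps)
  have "((\<lambda>h. tprob t g h * \<phi> h) has_sum (expect \<psi> t g - expect W t g)) UNIV"
    unfolding eq expect_def by (intro has_sum_diff has_sum_infsum lW l\<psi>)
  then show "(\<lambda>h. tprob t g h * \<phi> h) summable_on UNIV"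
    by (auto simp: summable_on_def)
  have "expect \<phi> t g = expect \<psi> t g - expect W t g"
    unfolding expect_def[of \<phi>] by (rule infsumI) fact
  moreover have "trunc_exp n \<phi> t g = trunc_exp n \<psi> t g - trunc_exp n W t g" for n
    using trunc_exp_linear[OF g, of n 1 \<psi> "-1" W] by (simp add: \<psi>_def)
  ultimately show "(\<lambda>n. trunc_exp n \<phi> t g) \<longlonglongrightarrow> expect \<phi> t g"
    using tendsto_diff[OF l\<psi>(2) lW(2)] by simp
qed

section \<open>The generator, the integral formula and time derivatives\<close>

definition gen :: "('a \<Rightarrow> real) \<Rightarrow> 'a \<Rightarrow> real" where
  "gen \<phi> h = (\<Sum>e\<in>jumps h. rate h e * (\<phi> (dest h e) - \<phi> h))"

lemma gen_eq: "gen \<phi> h = jump_op \<phi> h - exit_rate h * \<phi> h"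
  by (simp add: gen_def jump_op_def exit_rate_def right_diff_distrib sum_subtractf sum_distrib_right)

text \<open>Applying the generator costs one power of \<open>L\<close> through the exit rate.
  Functions of linear growth are therefore those whose image stays below a multiple of the square of
  \<open>L\<close>, whose expectation is under control.\<close>

definition lin_growth :: "('a \<Rightarrow> real) \<Rightarrow> bool" where
  "lin_growth \<phi> \<longleftrightarrow> (\<exists>c. \<forall>h\<in>S. \<bar>\<phi> h\<bar> \<le> c * L h)"

lemma lin_growthE:
  assumes "lin_growth \<phi>"
  obtains c where "c \<ge> 0" "\<And>h. h \<in> S \<Longrightarrow> \<bar>\<phi> h\<bar> \<le> c * L h"
proof -
  obtain c where c: "\<And>h. h \<in> S \<Longrightarrow> \<bar>\<phi> h\<bar> \<le> c * L h"
    using assms by (auto simp: lin_growth_def)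
  have "\<bar>\<phi> h\<bar> \<le> max c 0 * L h" if "h \<in> S" for h
    using L_ge_1[OF that] by (intro order_trans[OF c[OF that]] mult_right_mono) auto
  then show ?thesis
    by (intro that[of "max c 0"]) auto
qed

lemma lin_growth_quadratic:
  assumes "lin_growth \<phi>"
  obtains c where "\<And>h. h \<in> S \<Longrightarrow> \<bar>\<phi> h\<bar> \<le> c * (L h)\<^sup>2"
    "\<And>h. h \<in> S \<Longrightarrow> \<bar>jump_op \<phi> h\<bar> \<le> c * (L h)\<^sup>2"
    "\<And>h. h \<in> S \<Longrightarrow> \<bar>exit_rate h * \<phi> h\<bar> \<le> c * (L h)\<^sup>2"
    "\<And>h. h \<in> S \<Longrightarrow> \<bar>gen \<phi> h\<bar> \<le> c * (L h)\<^sup>2"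
proof -
  obtain c where c: "c \<ge> 0" "\<And>h. h \<in> S \<Longrightarrow> \<bar>\<phi> h\<bar> \<le> c * L h"
    using lin_growthE[OF assms] by metis
  \<comment> \<open>Chosen to dominate the four constants \<open>c\<close>,
    \<open>c * M * (1 + d)\<close>, \<open>c * M\<close> and \<open>c * M * (2 + d)\<close> that
    arise below.\<close>
  define b where "b = c + c * M * (2 + d)"
  have *: "\<bar>\<phi> h\<bar> \<le> c * (L h)\<^sup>2" "\<bar>jump_op \<phi> h\<bar> \<le> c * M * (1 + d) * (L h)\<^sup>2"
    "\<bar>exit_rate h * \<phi> h\<bar> \<le> c * M * (L h)\<^sup>2" if h: "h \<in> S" for h
  proof -
    note L = L_ge_1[OF h]
    have "c * L h \<le> c * (L h)\<^sup>2"
      using L c(1) by (intro mult_left_mono) (auto simp: power2_eq_square)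
    then show "\<bar>\<phi> h\<bar> \<le> c * (L h)\<^sup>2"
      using c(2)[OF h] by simp
    have "\<bar>jump_op \<phi> h\<bar> \<le> (\<Sum>e\<in>jumps h. \<bar>rate h e * \<phi> (dest h e)\<bar>)"
      unfolding jump_op_def by (rule sum_abs)
    also have "\<dots> \<le> (\<Sum>e\<in>jumps h. rate h e * (c * (L h + d)))"
    proof (rule sum_mono)
      fix e assume e: "e \<in> jumps h"
      have "\<bar>\<phi> (dest h e)\<bar> \<le> c * (L h + d)"
        using c(2)[OF dest_closed[OF h e]] mult_left_mono[OF L_dest[OF h e] c(1)] by simp
      then show "\<bar>rate h e * \<phi> (dest h e)\<bar> \<le> rate h e * (c * (L h + d))"
        using rate_nonneg[OF h e] by (simp add: abs_mult mult_left_mono)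
    qed
    also have "\<dots> = exit_rate h * (c * (L h + d))"
      by (simp add: exit_rate_def sum_distrib_right)
    also have "\<dots> \<le> (M * L h) * (c * (L h + d * L h))"
    proof (intro mult_mono exit_rate_le h mult_left_mono add_left_mono)
      show "d \<le> d * L h"
        using mult_left_mono[OF L d_nonneg] by simp
    qed (use c(1) d_nonneg M_nonneg L in auto)
    finally show "\<bar>jump_op \<phi> h\<bar> \<le> c * M * (1 + d) * (L h)\<^sup>2"
      by (simp add: power2_eq_square algebra_simps)
    have "\<bar>exit_rate h * \<phi> h\<bar> \<le> (M * L h) * (c * L h)"
      unfolding abs_mult using exit_rate_nonneg[OF h] exit_rate_le[OF h] c(2)[OF h] M_nonneg L
      by (intro mult_mono) auto
    then show "\<bar>exit_rate h * \<phi> h\<bar> \<le> c * M * (L h)\<^sup>2"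
      by (simp add: power2_eq_square algebra_simps)
  qed
  have cM: "0 \<le> c * M" "0 \<le> c * M * d"
    using c(1) M_nonneg d_nonneg by auto
  have up: "x \<le> b * (L h)\<^sup>2" if "x \<le> a * (L h)\<^sup>2" "a \<le> b" for x a h
    using that mult_right_mono[OF that(2), of "(L h)\<^sup>2"] by simp
  show ?thesis
  proof (rule that[of b])
    fix h assume h: "h \<in> S"
    show "\<bar>\<phi> h\<bar> \<le> b * (L h)\<^sup>2"
      by (rule up[OF *(1)[OF h]]) (use c(1) cM in \<open>auto simp: b_def algebra_simps\<close>)
    show "\<bar>jump_op \<phi> h\<bar> \<le> b * (L h)\<^sup>2"
      by (rule up[OF *(2)[OF h]]) (use c(1) cM in \<open>auto simp: b_def algebra_simps\<close>)
    show "\<bar>exit_rate h * \<phi> h\<bar> \<le> b * (L h)\<^sup>2"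
      by (rule up[OF *(3)[OF h]]) (use c(1) cM in \<open>auto simp: b_def algebra_simps\<close>)
    have "\<bar>gen \<phi> h\<bar> \<le> c * M * (1 + d) * (L h)\<^sup>2 + c * M * (L h)\<^sup>2"
      unfolding gen_eq using *(2,3)[OF h] by linarith
    also have "\<dots> = c * M * (2 + d) * (L h)\<^sup>2"
      by (simp add: algebra_simps)
    finally show "\<bar>gen \<phi> h\<bar> \<le> b * (L h)\<^sup>2"
      by (rule up) (use c(1) in \<open>auto simp: b_def\<close>)
  qed
qed

lemma lin_growth_summable:
  assumes "lin_growth \<phi>" "g \<in> S" "t \<ge> 0"
  shows "(\<lambda>h. tprob t g h * \<phi> h) summable_on UNIV"
  using assms by (metis lin_growth_quadratic expect_lim(1))

text \<open>Dynkin's formula: let \<open>n\<close> tend to infinity in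
  \<open>trunc_exp_forward\<close>. The Lyapunov estimate dominates the integrands uniformly in
  \<open>n\<close>, so dominated convergence applies.\<close>

lemma expect_integral:
  assumes \<phi>: "lin_growth \<phi>" and g: "g \<in> S" "t \<ge> 0"
  shows "((\<lambda>s. expect (gen \<phi>) s g) has_integral (expect \<phi> t g - \<phi> g)) {0..t}"
proof -
  define q\<phi> where "q\<phi> = (\<lambda>h. exit_rate h * \<phi> h)"
  obtain c where c: "\<And>h. h \<in> S \<Longrightarrow> \<bar>\<phi> h\<bar> \<le> c * (L h)\<^sup>2"
    "\<And>h. h \<in> S \<Longrightarrow> \<bar>jump_op \<phi> h\<bar> \<le> c * (L h)\<^sup>2"
    "\<And>h. h \<in> S \<Longrightarrow> \<bar>q\<phi> h\<bar> \<le> c * (L h)\<^sup>2"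
    using lin_growth_quadratic[OF \<phi>] unfolding q\<phi>_def by metis
  define F where "F = (\<lambda>n s. trunc_exp n (jump_op \<phi>) s g - trunc_exp (Suc n) q\<phi> s g)"
  define D where "D s = 2 * (c * (exp (growth * s) * (L g)\<^sup>2))" for s
  have lim: "(\<lambda>n. F n s) \<longlonglongrightarrow> expect (gen \<phi>) s g" if s: "s \<in> {0..t}" for s
  proof -
    have s0: "s \<ge> 0" using s by simp
    \<comment> \<open>Gain and loss part converge separately, since both have quadratic growth; the
      shifted index in the loss part does not affect its limit.\<close>
    have "(\<lambda>n. F n s) \<longlonglongrightarrow> expect (jump_op \<phi>) s g - expect q\<phi> s g"
      unfolding F_def
      by (intro tendsto_diff expect_lim(2)[OF c(2) g(1) s0] LIMSEQ_Suc[OF expect_lim(2)[OF c(3) g(1) s0]])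
    also have "expect (jump_op \<phi>) s g - expect q\<phi> s g = expect (gen \<phi>) s g"
      using infsumI[OF has_sum_diff[OF has_sum_infsum[OF expect_lim(1)[OF c(2) g(1) s0]]
          has_sum_infsum[OF expect_lim(1)[OF c(3) g(1) s0]]]]
      by (simp add: expect_def gen_eq right_diff_distrib q\<phi>_def)
    finally show ?thesis .
  qed
  have int: "(F n has_integral (trunc_exp (Suc n) \<phi> t g - \<phi> g)) {0..t}" for n
    using trunc_exp_forward[OF g, of n \<phi>] by (simp only: F_def q\<phi>_def)
  have bound: "norm (F n s) \<le> D s" if "s \<in> {0..t}" for n s
    using trunc_exp_abs_le[OF c(2) g(1), of s n] trunc_exp_abs_le[OF c(3) g(1), of s "Suc n"] that
    unfolding F_def D_def real_norm_def by fastforce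
  have D: "D integrable_on {0..t}"
    unfolding D_def by (intro integrable_continuous_real continuous_intros)
  have 1: "(\<lambda>s. expect (gen \<phi>) s g) integrable_on {0..t}"
    and 2: "(\<lambda>n. integral {0..t} (F n)) \<longlonglongrightarrow> integral {0..t} (\<lambda>s. expect (gen \<phi>) s g)"
    using dominated_convergence[where g = "\<lambda>s. expect (gen \<phi>) s g", OF has_integral_integrable[OF int] D bound lim]
    by simp_all
  have "(\<lambda>n. trunc_exp (Suc n) \<phi> t g - \<phi> g) \<longlonglongrightarrow> expect \<phi> t g - \<phi> g"
    by (intro tendsto_intros LIMSEQ_Suc[OF expect_lim(2)[OF c(1) g]])
  with 2 have "integral {0..t} (\<lambda>s. expect (gen \<phi>) s g) = expect \<phi> t g - \<phi> g"
    unfolding integral_unique[OF int] by (rule LIMSEQ_unique)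
  with 1 show ?thesis
    by (simp add: has_integral_integral[symmetric] has_integral_iff)
qed

lemma expect_continuous:
  assumes "lin_growth \<phi>" "g \<in> S"
  shows "continuous_on {0..b} (\<lambda>t. expect \<phi> t g)"
proof (cases "b \<ge> 0")
  case True
  have "continuous_on {0..b} (\<lambda>t. \<phi> g + integral {0..t} (\<lambda>s. expect (gen \<phi>) s g))"
    by (intro continuous_intros indefinite_integral_continuous_1
        has_integral_integrable[OF expect_integral] assms True)
  then show ?thesis
    by (rule continuous_on_eq) (simp add: integral_unique[OF expect_integral[OF assms]])
qed simp

text \<open>The assumption on \<open>gen \<phi>\<close> makes \<open>expect_continuous\<close>
  applicable to the integrand of Dynkin's formula, which can then be differentiated at every time,
  including 0 from the right.\<close>

lemma expect_deriv:
  assumes "lin_growth \<phi>" "lin_growth (gen \<phi>)" "g \<in> S" "t \<ge> 0"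
  shows "((\<lambda>t. expect \<phi> t g) has_real_derivative expect (gen \<phi>) t g) (at t within {0..})"
proof -
  have "((\<lambda>u. integral {0..u} (\<lambda>s. expect (gen \<phi>) s g)) has_real_derivative expect (gen \<phi>) t g)
      (at t within {0..t+1})"
    using assms by (intro integral_has_real_derivative expect_continuous) auto
  then have "((\<lambda>u. integral {0..u} (\<lambda>s. expect (gen \<phi>) s g) + \<phi> g) has_real_derivative expect (gen \<phi>) t g)
      (at t within {0..t+1})"
    by (auto intro!: derivative_eq_intros)
  then have "((\<lambda>u. integral {0..u} (\<lambda>s. expect (gen \<phi>) s g) + \<phi> g) has_real_derivative expect (gen \<phi>) t g)
      (at t within {0..})"
    by (subst (asm) at_within_nhd[of _ "{..<t+1}" _ "{0..}"]) auto
  then show ?thesis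
    by (rule has_field_derivative_transform_within[OF _ zero_less_one])
       (use assms in \<open>auto simp: integral_unique[OF expect_integral[OF assms(1,3)]]\<close>)
qed

lemma expect_time_0:
  assumes "lin_growth \<phi>" "g \<in> S"
  shows "expect \<phi> 0 g = \<phi> g"
proof -
  have "((\<lambda>s. expect (gen \<phi>) s g) has_integral 0) {0..0}"
    using has_integral_refl(2)[of _ "0::real"] by simp
  from has_integral_unique[OF expect_integral[OF assms order.refl] this] show ?thesis
    by simp
qed

lemma expect_constant:
  assumes "lin_growth \<phi>" "g \<in> S" "t \<ge> 0" "\<And>h. h \<in> S \<Longrightarrow> gen \<phi> h = 0"
  shows "expect \<phi> t g = \<phi> g"
proof -
  have "expect (gen \<phi>) s g = 0" if "s \<in> {0..t}" for s
    unfolding expect_def using assms(4) tprob_outside[OF assms(2), of s] that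
    by (intro infsum_0) (metis atLeastAtMost_iff mult_eq_0_iff)
  then have "((\<lambda>_. 0) has_integral (expect \<phi> t g - \<phi> g)) {0..t}"
    using has_integral_cong[of "{0..t}" "\<lambda>s. expect (gen \<phi>) s g" "\<lambda>_. 0"] expect_integral[OF assms(1-3)]
    by simp
  then show ?thesis
    using has_integral_unique has_integral_0 by fastforce
qed

lemma expect_cong:
  assumes "\<And>h. h \<in> S \<Longrightarrow> \<phi> h = \<psi> h" "g \<in> S" "t \<ge> 0"
  shows "expect \<phi> t g = expect \<psi> t g"
  unfolding expect_def using assms tprob_outside by (intro infsum_cong) (metis mult_eq_0_iff)

lemma expect_sum:
  assumes "finite T" "\<And>i. i \<in> T \<Longrightarrow> lin_growth (\<phi> i)" "g \<in> S" "t \<ge> 0"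
  shows "expect (\<lambda>h. \<Sum>i\<in>T. c i * \<phi> i h) t g = (\<Sum>i\<in>T. c i * expect (\<phi> i) t g)"
proof -
  have "expect (\<lambda>h. \<Sum>i\<in>T. c i * \<phi> i h) t g = (\<Sum>\<^sub>\<infinity>h. \<Sum>i\<in>T. c i * (tprob t g h * \<phi> i h))"
    by (simp add: expect_def sum_distrib_left mult.left_commute)
  also have "\<dots> = (\<Sum>i\<in>T. c i * expect (\<phi> i) t g)"
    unfolding expect_def using assms
    by (intro infsumI has_sum_sum has_sum_cmult_right has_sum_infsum lin_growth_summable)
  finally show ?thesis .
qed

lemma lin_growth_sum:
  assumes "finite T" "\<And>i. i \<in> T \<Longrightarrow> lin_growth (\<phi> i)"
  shows "lin_growth (\<lambda>h. \<Sum>i\<in>T. c i * \<phi> i h)"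
proof -
  obtain b where b: "\<And>i h. i \<in> T \<Longrightarrow> h \<in> S \<Longrightarrow> \<bar>\<phi> i h\<bar> \<le> b i * L h"
    using assms(2) unfolding lin_growth_def by metis
  have "\<bar>\<Sum>i\<in>T. c i * \<phi> i h\<bar> \<le> (\<Sum>i\<in>T. \<bar>c i\<bar> * b i) * L h" if "h \<in> S" for h
  proof -
    have "\<bar>\<Sum>i\<in>T. c i * \<phi> i h\<bar> \<le> (\<Sum>i\<in>T. \<bar>c i\<bar> * \<bar>\<phi> i h\<bar>)"
      using sum_abs[of "\<lambda>i. c i * \<phi> i h" T] by (simp add: abs_mult)
    also have "\<dots> \<le> (\<Sum>i\<in>T. \<bar>c i\<bar> * (b i * L h))"
      by (intro sum_mono mult_left_mono b that) auto
    finally show ?thesis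
      by (simp add: sum_distrib_right mult.assoc)
  qed
  then show ?thesis
    by (auto simp: lin_growth_def)
qed

end

subsection \<open>The interacting particle system\<close>

lemma other_end_simps:
  "x \<noteq> y \<Longrightarrow> other_end x {x, y} = y" "x \<noteq> y \<Longrightarrow> other_end y {x, y} = x"
proof -
  assume "x \<noteq> y"
  then have "{x, y} - {x} = {y}" "{x, y} - {y} = {x}"
    by auto
  then show "other_end x {x, y} = y" "other_end y {x, y} = x"
    by (simp_all add: other_end_def)
qed

lemma unit_vec_commute: "unit_vec y x = - unit_vec x y"
  using sgn_minus[of "y - x"] by (simp add: unit_vec_def)

lemma inner_unit_vec:
  fixes x y :: "'h::real_inner"
  shows "x \<noteq> y \<Longrightarrow> unit_vec x y \<bullet> unit_vec x y = 1"
  by (simp add: unit_vec_def dot_square_norm norm_sgn)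

lemma norm_unit_vec_le: "norm (unit_vec x y) \<le> 1"
  by (simp add: unit_vec_def norm_sgn)

text \<open>The second identity is the source of linearity: an edge fires at a rate proportional to
  \<open>norm v\<close> and moves a node by a sign, and the product is linear in
  \<open>v\<close>.\<close>

lemma parallel_unit_vec:
  fixes x y :: "'h::real_inner"
  assumes "v = c *\<^sub>R (y - x)" "x \<noteq> y"
  shows "v = (v \<bullet> unit_vec x y) *\<^sub>R unit_vec x y"
    and "norm v * sgn (v \<bullet> unit_vec x y) = v \<bullet> unit_vec x y"
proof -
  have "(y - x) \<bullet> unit_vec x y = norm (y - x)"
    using assms(2) by (simp add: unit_vec_def sgn_div_norm dot_square_norm power2_eq_square)
  then have v: "v \<bullet> unit_vec x y = c * norm (y - x)"
    using assms(1) by simp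
  have nv: "norm v = \<bar>c\<bar> * norm (y - x)"
    using assms(1) by simp
  show "v = (v \<bullet> unit_vec x y) *\<^sub>R unit_vec x y"
    unfolding v using assms by (simp add: unit_vec_def sgn_div_norm)
  show "norm v * sgn (v \<bullet> unit_vec x y) = v \<bullet> unit_vec x y"
    unfolding v nv using assms(2) by (cases c "0::real" rule: linorder_cases) (auto simp: sgn_mult)
qed

text \<open>\<open>F0\<close> relaxed to real values. Closure under jumps then amounts to keeping
  the support finite and inside the graph and the edge values parallel to their edges.\<close>

definition conf :: "('h::real_normed_vector) set \<Rightarrow> 'h set set \<Rightarrow> 'h state set" where
  "conf V E = {g. finite {x. fst g x \<noteq> 0} \<and> finite {\<epsilon>. snd g \<epsilon> \<noteq> 0} \<and>
      (\<forall>x. x \<notin> V \<longrightarrow> fst g x = 0) \<and> (\<forall>\<epsilon>. \<epsilon> \<notin> E \<longrightarrow> snd g \<epsilon> = 0) \<and>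
      (\<forall>x y. {x, y} \<in> E \<longrightarrow> (\<exists>c. snd g {x, y} = c *\<^sub>R (y - x)))}"

lemma F0_subset_conf: "F0 V E \<subseteq> conf V E"
  by (auto simp: F0_def conf_def)

definition mass :: "('h::real_normed_vector) state \<Rightarrow> real" where
  "mass g = (\<Sum>x | fst g x \<noteq> 0. \<bar>fst g x\<bar>) + (\<Sum>\<epsilon> | snd g \<epsilon> \<noteq> 0. norm (snd g \<epsilon>))"

lemma mass_nonneg: "mass g \<ge> 0"
  unfolding mass_def by (intro add_nonneg_nonneg sum_nonneg) auto

text \<open>Lets the masses before and after a jump be compared over common index sets, although the
  supports differ.\<close>

lemma mass_eq:
  assumes "finite T" "{x. fst g x \<noteq> 0} \<subseteq> T" "finite U" "{\<epsilon>. snd g \<epsilon> \<noteq> 0} \<subseteq> U"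
  shows "mass g = (\<Sum>x\<in>T. \<bar>fst g x\<bar>) + (\<Sum>\<epsilon>\<in>U. norm (snd g \<epsilon>))"
  unfolding mass_def using assms by (intro arg_cong2[of _ _ _ _ plus] sum.mono_neutral_left) auto

lemma fst_le_mass:
  assumes "g \<in> conf V E"
  shows "\<bar>fst g x\<bar> \<le> mass g"
proof -
  have "\<bar>fst g x\<bar> \<le> (\<Sum>x\<in>insert x {x. fst g x \<noteq> 0}. \<bar>fst g x\<bar>)"
    by (rule member_le_sum[of x _ "\<lambda>x. \<bar>fst g x\<bar>"]) (use assms in \<open>auto simp: conf_def\<close>)
  also have "\<dots> \<le> mass g"
    by (subst mass_eq[where T = "insert x {x. fst g x \<noteq> 0}" and U = "{\<epsilon>. snd g \<epsilon> \<noteq> 0}"])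
       (use assms in \<open>auto simp: conf_def intro!: sum_nonneg\<close>)
  finally show ?thesis .
qed

lemma snd_le_mass:
  assumes "g \<in> conf V E"
  shows "norm (snd g \<epsilon>) \<le> mass g"
proof -
  have "norm (snd g \<epsilon>) \<le> (\<Sum>\<epsilon>\<in>insert \<epsilon> {\<epsilon>. snd g \<epsilon> \<noteq> 0}. norm (snd g \<epsilon>))"
    by (rule member_le_sum[of \<epsilon> _ "\<lambda>\<epsilon>. norm (snd g \<epsilon>)"]) (use assms in \<open>auto simp: conf_def\<close>)
  also have "\<dots> \<le> mass g"
    by (subst mass_eq[where T = "{x. fst g x \<noteq> 0}" and U = "insert \<epsilon> {\<epsilon>. snd g \<epsilon> \<noteq> 0}"])
       (use assms in \<open>auto simp: conf_def intro!: sum_nonneg\<close>)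
  finally show ?thesis .
qed

text \<open>Meant for a single jump: \<open>Z\<close> holds the coordinates that it touches, each
  growing in size by at most 1.\<close>

lemma sum_le_sum_plus_card:
  fixes a b :: "'a \<Rightarrow> real"
  assumes "finite T" "finite Z" "\<And>i. a i \<le> b i + (if i \<in> Z then 1 else 0)"
  shows "(\<Sum>i\<in>T. a i) \<le> (\<Sum>i\<in>T. b i) + card Z"
proof -
  have "(\<Sum>i\<in>T. a i) \<le> (\<Sum>i\<in>T. b i + (if i \<in> Z then 1 else 0))"
    by (intro sum_mono assms)
  also have "\<dots> = (\<Sum>i\<in>T. b i) + card (T \<inter> Z)"
    using assms(1) by (simp add: sum.distrib sum.If_cases Int_def)
  also have "card (T \<inter> Z) \<le> card Z"
    using assms(2) by (intro card_mono) auto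
  finally show ?thesis by simp
qed

section \<open>The particle system as a jump process\<close>

locale particle_system =
  fixes V :: "('h::{real_inner,complete_space}) set" and E :: "'h set set"
    and k :: "'h set \<Rightarrow> real" and m :: "'h \<Rightarrow> real" and V0 V1 :: "'h set" and D :: nat and M :: real
  assumes edge_ends: "\<epsilon> \<in> E \<Longrightarrow> \<exists>x y. \<epsilon> = {x, y} \<and> x \<noteq> y \<and> x \<in> V \<and> y \<in> V"
    and k_nonneg: "\<epsilon> \<in> E \<Longrightarrow> k \<epsilon> \<ge> 0"
    and m_pos: "x \<in> V \<Longrightarrow> m x > 0"
    and finite_nbrs: "x \<in> V \<Longrightarrow> finite {y. {x, y} \<in> E}"
    and card_nbrs: "x \<in> V \<Longrightarrow> card {y. {x, y} \<in> E} \<le> D"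
    and m_bound: "x \<in> V \<Longrightarrow> 1 / m x \<le> M"
    and k_bound: "\<epsilon> \<in> E \<Longrightarrow> k \<epsilon> \<le> M"
    and M0: "M \<ge> 0"
    and V_split: "V0 \<union> V1 = V" "V0 \<inter> V1 = {}"
begin

lemma edge_neq: "{x, y} \<in> E \<Longrightarrow> x \<noteq> y"
  by (drule edge_ends) (auto simp: doubleton_eq_iff)

lemma edge_in_V: "{x, y} \<in> E \<Longrightarrow> x \<in> V \<and> y \<in> V"
  by (drule edge_ends) (auto simp: doubleton_eq_iff)

lemma edges_at: "{\<epsilon>\<in>E. x \<in> \<epsilon>} = (\<lambda>y. {x, y}) ` {y. {x, y} \<in> E}"
proof (intro equalityI subsetI)
  fix \<epsilon> assume \<epsilon>: "\<epsilon> \<in> {\<epsilon>\<in>E. x \<in> \<epsilon>}"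
  then obtain a b where "\<epsilon> = {a, b}"
    using edge_ends by blast
  with \<epsilon> obtain y where "\<epsilon> = {x, y}"
    by (metis (no_types, lifting) insert_commute insert_iff mem_Collect_eq singletonD)
  with \<epsilon> show "\<epsilon> \<in> (\<lambda>y. {x, y}) ` {y. {x, y} \<in> E}"
    by auto
qed auto

lemma finite_edges_at: "x \<in> V \<Longrightarrow> finite {\<epsilon>\<in>E. x \<in> \<epsilon>}"
  unfolding edges_at by (intro finite_imageI finite_nbrs)

lemma card_edges_at: "x \<in> V \<Longrightarrow> card {\<epsilon>\<in>E. x \<in> \<epsilon>} \<le> D"
  unfolding edges_at by (rule order_trans[OF card_image_le[OF finite_nbrs] card_nbrs])

lemma card_edge: "\<epsilon> \<in> E \<Longrightarrow> finite \<epsilon> \<and> card \<epsilon> = 2"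
  by (drule edge_ends) auto

lemma active_subset:
  "active V E k m V0 g \<subseteq> NodeEv ` {x. fst g x \<noteq> 0} \<union> EdgeEv ` {\<epsilon>. snd g \<epsilon> \<noteq> 0}"
  by (auto simp: active_def events_def)

lemma finite_active:
  assumes "g \<in> conf V E"
  shows "finite (active V E k m V0 g)"
  by (rule finite_subset[OF active_subset]) (use assms in \<open>auto simp: conf_def\<close>)

lemma ev_rate_nonneg: "ev \<in> events V E \<Longrightarrow> ev_rate k m g ev \<ge> 0"
  using m_pos k_nonneg by (auto simp: events_def less_imp_le)

text \<open>Active events sit on the support of the state, where each rate is at most
  \<open>M\<close> times the size of its coordinate.\<close>

lemma total_rate_le_mass:
  assumes g: "g \<in> conf V E"
  shows "(\<Sum>ev\<in>active V E k m V0 g. ev_rate k m g ev) \<le> M * mass g"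
proof -
  let ?X = "{x. fst g x \<noteq> 0}" and ?Y = "{\<epsilon>. snd g \<epsilon> \<noteq> 0}"
  have fin: "finite ?X" "finite ?Y" and sub: "?X \<subseteq> V" "?Y \<subseteq> E"
    using g by (auto simp: conf_def)
  have "(\<Sum>ev\<in>active V E k m V0 g. ev_rate k m g ev) \<le> (\<Sum>ev\<in>NodeEv ` ?X \<union> EdgeEv ` ?Y. ev_rate k m g ev)"
    by (rule sum_mono2) (use fin sub active_subset in \<open>auto simp: events_def intro!: ev_rate_nonneg\<close>)
  also have "\<dots> = (\<Sum>x\<in>?X. \<bar>fst g x\<bar> / m x) + (\<Sum>\<epsilon>\<in>?Y. k \<epsilon> * norm (snd g \<epsilon>))"
    using fin by (subst sum.union_disjoint) (auto simp: sum.reindex inj_on_def)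
  also have "\<dots> \<le> (\<Sum>x\<in>?X. M * \<bar>fst g x\<bar>) + (\<Sum>\<epsilon>\<in>?Y. M * norm (snd g \<epsilon>))"
  proof (intro add_mono sum_mono)
    show "\<bar>fst g x\<bar> / m x \<le> M * \<bar>fst g x\<bar>" if "x \<in> ?X" for x
      using mult_right_mono[OF m_bound[of x], of "\<bar>fst g x\<bar>"] that sub by auto
    show "k \<epsilon> * norm (snd g \<epsilon>) \<le> M * norm (snd g \<epsilon>)" if "\<epsilon> \<in> ?Y" for \<epsilon>
      using that sub by (intro mult_right_mono k_bound) auto
  qed
  also have "\<dots> = M * mass g"
    by (simp add: mass_def sum_distrib_left distrib_left)
  finally show ?thesis .
qed

text \<open>A node event changes at most \<open>D\<close> edge values by vectors of norm at most 1;
  an edge event changes at most two node values by at most 1. The constant \<open>D + 2\<close>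
  covers both.\<close>

lemma ev_target_closed:
  assumes g: "g \<in> conf V E" and ev: "ev \<in> events V E"
  shows "ev_target E V0 g ev \<in> conf V E \<and> mass (ev_target E V0 g ev) \<le> mass g + (D + 2)"
proof (cases ev)
  case (NodeEv x)
  then have x: "x \<in> V"
    using ev by (auto simp: events_def)
  let ?g = "ev_target E V0 g ev" and ?Z = "{\<epsilon>\<in>E. x \<in> \<epsilon>}"
  let ?T = "{x. fst g x \<noteq> 0}" and ?U = "{\<epsilon>. snd g \<epsilon> \<noteq> 0} \<union> ?Z"
  have fst_g: "fst ?g = fst g"
    by (simp add: NodeEv)
  have snd_g: "snd ?g \<epsilon> = (if \<epsilon> \<in> ?Z then snd g \<epsilon> + sgn (fst g x) *\<^sub>R unit_vec (other_end x \<epsilon>) x else snd g \<epsilon>)" for \<epsilon>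
    by (simp add: NodeEv)
  have fin: "finite ?T" "finite ?U"
    using g finite_edges_at[OF x] by (auto simp: conf_def)
  have sub: "{\<epsilon>. snd ?g \<epsilon> \<noteq> 0} \<subseteq> ?U"
    using snd_g by auto
  have "\<exists>c. snd ?g {a, b} = c *\<^sub>R (b - a)" if ab: "{a, b} \<in> E" for a b
  proof -
    obtain c where c: "snd g {a, b} = c *\<^sub>R (b - a)"
      using g ab unfolding conf_def by blast
    show ?thesis
    proof (cases "x \<in> {a, b}")
      case True
      \<comment> \<open>The firing node may be either endpoint, so the added vector agrees with the
        unit vector of the edge only up to sign.\<close>
      then have "unit_vec (other_end x {a, b}) x \<in> {unit_vec a b, - unit_vec a b}"
        using edge_neq[OF ab] unit_vec_commute[of a b] by (auto simp: other_end_simps)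
      then obtain c' where "unit_vec (other_end x {a, b}) x = c' *\<^sub>R (b - a)"
        unfolding unit_vec_def sgn_div_norm by (metis insertE scaleR_minus_left singletonD)
      then have "snd ?g {a, b} = (c + sgn (fst g x) * c') *\<^sub>R (b - a)"
        using True ab c by (simp add: snd_g scaleR_left_distrib)
      then show ?thesis by blast
    qed (use c in \<open>auto simp: snd_g\<close>)
  qed
  moreover have "\<forall>\<epsilon>. \<epsilon> \<notin> E \<longrightarrow> snd ?g \<epsilon> = 0"
    using g by (auto simp: conf_def snd_g)
  ultimately have "?g \<in> conf V E"
    using g finite_subset[OF sub fin(2)] unfolding conf_def mem_Collect_eq fst_g by blast
  moreover have "mass ?g \<le> mass g + (D + 2)"
  proof -
    have "(\<Sum>\<epsilon>\<in>?U. norm (snd ?g \<epsilon>)) \<le> (\<Sum>\<epsilon>\<in>?U. norm (snd g \<epsilon>)) + card ?Z"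
    proof (rule sum_le_sum_plus_card)
      fix \<epsilon>
      have "norm (sgn (fst g x) *\<^sub>R unit_vec (other_end x \<epsilon>) x) \<le> 1"
        using norm_unit_vec_le[of "other_end x \<epsilon>" x] by (simp add: abs_sgn_eq)
      then show "norm (snd ?g \<epsilon>) \<le> norm (snd g \<epsilon>) + (if \<epsilon> \<in> ?Z then 1 else 0)"
        unfolding snd_g using norm_triangle_ineq[of "snd g \<epsilon>" "sgn (fst g x) *\<^sub>R unit_vec (other_end x \<epsilon>) x"]
        by simp
    qed (use fin finite_edges_at[OF x] in auto)
    moreover have "mass ?g = (\<Sum>x\<in>?T. \<bar>fst ?g x\<bar>) + (\<Sum>\<epsilon>\<in>?U. norm (snd ?g \<epsilon>))"
      by (rule mass_eq) (use fin sub fst_g in auto)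
    moreover have "mass g = (\<Sum>x\<in>?T. \<bar>fst g x\<bar>) + (\<Sum>\<epsilon>\<in>?U. norm (snd g \<epsilon>))"
      by (rule mass_eq) (use fin in auto)
    ultimately show ?thesis
      using card_edges_at[OF x] unfolding fst_g by linarith
  qed
  ultimately show ?thesis ..
next
  case (EdgeEv \<epsilon>)
  then have \<epsilon>: "\<epsilon> \<in> E"
    using ev by (auto simp: events_def)
  let ?g = "ev_target E V0 g ev"
  let ?T = "{x. fst g x \<noteq> 0} \<union> \<epsilon>" and ?U = "{\<epsilon>. snd g \<epsilon> \<noteq> 0}"
  have snd_g: "snd ?g = snd g"
    by (simp add: EdgeEv)
  have fst_g: "fst ?g z = (if z \<in> V0 \<and> z \<in> \<epsilon> then fst g z + sgn (snd g \<epsilon> \<bullet> unit_vec z (other_end z \<epsilon>)) else fst g z)" for z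
    by (simp add: EdgeEv)
  have fin: "finite ?T" "finite ?U"
    using g card_edge[OF \<epsilon>] by (auto simp: conf_def)
  have sub: "{x. fst ?g x \<noteq> 0} \<subseteq> ?T"
    using fst_g by auto
  have "\<forall>x. x \<notin> V \<longrightarrow> fst ?g x = 0"
    using g V_split by (auto simp: conf_def fst_g)
  then have "?g \<in> conf V E"
    using g finite_subset[OF sub fin(1)] unfolding conf_def mem_Collect_eq snd_g by blast
  moreover have "mass ?g \<le> mass g + (D + 2)"
  proof -
    have "(\<Sum>x\<in>?T. \<bar>fst ?g x\<bar>) \<le> (\<Sum>x\<in>?T. \<bar>fst g x\<bar>) + card \<epsilon>"
      by (rule sum_le_sum_plus_card) (use fin card_edge[OF \<epsilon>] in \<open>auto simp: fst_g sgn_real_def\<close>)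
    moreover have "mass ?g = (\<Sum>x\<in>?T. \<bar>fst ?g x\<bar>) + (\<Sum>\<epsilon>\<in>?U. norm (snd ?g \<epsilon>))"
      by (rule mass_eq) (use fin sub snd_g in auto)
    moreover have "mass g = (\<Sum>x\<in>?T. \<bar>fst g x\<bar>) + (\<Sum>\<epsilon>\<in>?U. norm (snd g \<epsilon>))"
      by (rule mass_eq) (use fin in auto)
    ultimately show ?thesis
      using card_edge[OF \<epsilon>] unfolding snd_g by linarith
  qed
  ultimately show ?thesis ..
qed

text \<open>The shift by 1 gives the Lyapunov function its lower bound 1 even at the zero
  state.\<close>

sublocale jump_process "conf V E" "active V E k m V0" "ev_rate k m" "ev_target E V0"
  "\<lambda>g. mass g + 1" M "real (D + 2)"
proof
  fix g :: "'h state" assume g: "g \<in> conf V E"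
  have "M * mass g \<le> M * (mass g + 1)"
    using M0 by (intro mult_left_mono) auto
  with total_rate_le_mass[OF g]
  show "(\<Sum>ev\<in>active V E k m V0 g. ev_rate k m g ev) \<le> M * (mass g + 1)"
    by linarith
  fix ev assume "ev \<in> active V E k m V0 g"
  then have ev: "ev \<in> events V E"
    by (simp add: active_def)
  show "ev_rate k m g ev \<ge> 0" "ev_target E V0 g ev \<in> conf V E"
    "mass (ev_target E V0 g ev) + 1 \<le> mass g + 1 + real (D + 2)"
    using ev_rate_nonneg[OF ev] ev_target_closed[OF g ev] by auto
qed (use M0 finite_active mass_nonneg in auto)

text \<open>At most \<open>n\<close> jumps means fewer than \<open>n + 1\<close>, and both sides
  obey the same recursion. At the base the integral in \<open>trunc_exp\<close> vanishes because it
  involves \<open>trunc_exp 0\<close>.\<close>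

lemma trans_n_eq: "trans_n n V E k m V0 t f g = trunc_exp (Suc n) (point g) t f"
proof (induction n arbitrary: t f)
  case 0
  show ?case
    by (simp add: point_def jump_op_def exit_rate_def total_rate_def)
next
  case (Suc n)
  show ?case
    unfolding trans_n.simps(2) trunc_exp.simps(2)[of "Suc n"] Suc.IH
    by (simp add: point_def jump_op_def exit_rate_def total_rate_def del: trunc_exp.simps)
qed

lemma trans_eq: "trans V E k m V0 t f g = tprob t f g"
  by (simp add: trans_def tprob_def trans_n_eq del: trunc_exp.simps)

lemma exp_node_eq: "exp_node V E k m V0 f t x = expect (\<lambda>g. fst g x) t f"
  by (simp add: exp_node_def expect_def trans_eq)

lemma lin_growth_node: "lin_growth (\<lambda>g. fst g x)"
  unfolding lin_growth_def
  by (rule exI[of _ 1], intro ballI, rule order_trans[OF fst_le_mass]) auto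

lemma lin_growth_edge: "lin_growth (\<lambda>g. snd g {x, y} \<bullet> unit_vec x y)"
proof -
  have "\<bar>snd g {x, y} \<bullet> unit_vec x y\<bar> \<le> 1 * (mass g + 1)" if g: "g \<in> conf V E" for g
  proof -
    have "\<bar>snd g {x, y} \<bullet> unit_vec x y\<bar> \<le> norm (snd g {x, y}) * norm (unit_vec x y)"
      by (rule Cauchy_Schwarz_ineq2)
    also have "\<dots> \<le> norm (snd g {x, y}) * 1"
      by (intro mult_left_mono norm_unit_vec_le) auto
    finally show ?thesis
      using snd_le_mass[OF g, of "{x, y}"] by simp
  qed
  then show ?thesis
    unfolding lin_growth_def by blast
qed

lemma lin_growth_cong:
  assumes "lin_growth \<psi>" "\<And>g. g \<in> conf V E \<Longrightarrow> \<phi> g = \<psi> g"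
  shows "lin_growth \<phi>"
  using assms by (simp add: lin_growth_def)

lemma edge_parallel:
  assumes "g \<in> conf V E" "{x, y} \<in> E"
  shows "snd g {x, y} = (snd g {x, y} \<bullet> unit_vec x y) *\<^sub>R unit_vec x y"
    and "norm (snd g {x, y}) * sgn (snd g {x, y} \<bullet> unit_vec x y) = snd g {x, y} \<bullet> unit_vec x y"
proof -
  obtain c where "snd g {x, y} = c *\<^sub>R (y - x)"
    using assms unfolding conf_def by blast
  from parallel_unit_vec[OF this edge_neq[OF assms(2)]]
  show "snd g {x, y} = (snd g {x, y} \<bullet> unit_vec x y) *\<^sub>R unit_vec x y"
    and "norm (snd g {x, y}) * sgn (snd g {x, y} \<bullet> unit_vec x y) = snd g {x, y} \<bullet> unit_vec x y"
    by auto
qed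

text \<open>Every state of positive weight has its value on this edge along one fixed unit vector.
  The vector-valued mean thus reduces to a scalar expectation, to which the results on
  \<open>expect\<close> apply.\<close>

lemma exp_edge_eq:
  assumes "{x, y} \<in> E" "f \<in> conf V E" "t \<ge> 0"
  shows "exp_edge V E k m V0 f t {x, y} = expect (\<lambda>g. snd g {x, y} \<bullet> unit_vec x y) t f *\<^sub>R unit_vec x y"
proof -
  have "tprob t f g *\<^sub>R snd g {x, y} = (tprob t f g * (snd g {x, y} \<bullet> unit_vec x y)) *\<^sub>R unit_vec x y" for g
  proof (cases "g \<in> conf V E")
    case True
    show ?thesis
      by (subst edge_parallel(1)[OF True assms(1)]) simp
  qed (simp add: tprob_outside[OF assms(2,3)])
  then have "exp_edge V E k m V0 f t {x, y} =
      (\<Sum>\<^sub>\<infinity>g. (tprob t f g * (snd g {x, y} \<bullet> unit_vec x y)) *\<^sub>R unit_vec x y)"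
    by (simp add: exp_edge_def trans_eq)
  also have "\<dots> = expect (\<lambda>g. snd g {x, y} \<bullet> unit_vec x y) t f *\<^sub>R unit_vec x y"
    unfolding expect_def
    by (intro infsum_scaleR_left lin_growth_summable lin_growth_edge assms)
  finally show ?thesis .
qed

section \<open>The generator on coordinates\<close>

lemma gen_eq_sum:
  assumes "g \<in> conf V E" "finite T" "T \<subseteq> events V E"
    and "\<And>ev. ev \<in> events V E - T \<Longrightarrow> \<phi> (ev_target E V0 g ev) = \<phi> g"
  shows "gen \<phi> g = (\<Sum>ev\<in>T. ev_rate k m g ev * (\<phi> (ev_target E V0 g ev) - \<phi> g))"
proof -
  let ?s = "\<lambda>ev. ev_rate k m g ev * (\<phi> (ev_target E V0 g ev) - \<phi> g)"
  \<comment> \<open>The active set varies with \<open>g\<close>, whereas \<open>T\<close> can be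
    chosen independently of it. Inactive events in \<open>T\<close> contribute 0, having rate 0 or
    target \<open>g\<close>; active events outside \<open>T\<close> leave \<open>\<phi>\<close>
    unchanged.\<close>
  have "gen \<phi> g = sum ?s (active V E k m V0 g \<union> T)"
    unfolding gen_def
    by (rule sum.mono_neutral_left) (use assms finite_active in \<open>auto simp: active_def\<close>)
  also have "\<dots> = sum ?s T"
    by (rule sum.mono_neutral_right) (use assms finite_active in \<open>auto simp: active_def\<close>)
  finally show ?thesis .
qed

text \<open>Node events and edges away from \<open>x\<close> leave this coordinate fixed. An edge at
  \<open>x\<close> contributes its rate times the sign of its oriented value, and
  \<open>edge_parallel(2)\<close> makes this product linear in the state.\<close>

lemma gen_node:
  assumes g: "g \<in> conf V E" and x: "x \<in> V0"
  shows "gen (\<lambda>g. fst g x) g = (\<Sum>y\<in>{y. {x, y} \<in> E}. k {x, y} * (snd g {x, y} \<bullet> unit_vec x y))"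
proof -
  let ?N = "{y. {x, y} \<in> E}"
  have inj: "inj_on (\<lambda>y. EdgeEv {x, y}) ?N"
    by (auto simp: inj_on_def doubleton_eq_iff)
  have "gen (\<lambda>g. fst g x) g = (\<Sum>ev\<in>(\<lambda>y. EdgeEv {x, y}) ` ?N.
      ev_rate k m g ev * (fst (ev_target E V0 g ev) x - fst g x))"
  proof (rule gen_eq_sum[OF g])
    show "finite ((\<lambda>y. EdgeEv {x, y}) ` ?N)"
      using finite_nbrs x V_split by auto
    show "(\<lambda>y. EdgeEv {x, y}) ` ?N \<subseteq> events V E"
      by (auto simp: events_def)
    fix ev assume ev: "ev \<in> events V E - (\<lambda>y. EdgeEv {x, y}) ` ?N"
    show "fst (ev_target E V0 g ev) x = fst g x"
    proof (cases ev)
      case (EdgeEv \<epsilon>)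
      have "x \<notin> \<epsilon>"
        using ev edges_at[of x] by (auto simp: EdgeEv events_def)
      then show ?thesis by (simp add: EdgeEv)
    qed simp
  qed
  also have "\<dots> = (\<Sum>y\<in>?N. k {x, y} * norm (snd g {x, y}) * sgn (snd g {x, y} \<bullet> unit_vec x y))"
    unfolding sum.reindex[OF inj] by (rule sum.cong) (use x edge_neq in \<open>auto simp: other_end_simps\<close>)
  also have "\<dots> = (\<Sum>y\<in>?N. k {x, y} * (snd g {x, y} \<bullet> unit_vec x y))"
    by (rule sum.cong) (use edge_parallel(2)[OF g] in \<open>auto simp: mult.assoc\<close>)
  finally show ?thesis .
qed

lemma gen_node_fixed:
  assumes "g \<in> conf V E" "x \<in> V1"
  shows "gen (\<lambda>g. fst g x) g = 0"
proof -
  have "fst (ev_target E V0 g ev) x = fst g x" for ev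
    using assms V_split by (cases ev) auto
  then show ?thesis
    by (simp add: gen_def)
qed

text \<open>Only the two endpoints move this value: firing \<open>x\<close> adds a multiple of
  \<open>unit_vec y x\<close>, the negative of \<open>unit_vec x y\<close>, and firing
  \<open>y\<close> one of \<open>unit_vec x y\<close> itself. Absolute value times sign restores
  linearity. The weighted sum over \<open>{x, y}\<close> suits \<open>lin_growth_sum\<close> and
  \<open>expect_sum\<close>.\<close>

lemma gen_edge:
  assumes g: "g \<in> conf V E" and xy: "{x, y} \<in> E"
  shows "gen (\<lambda>g. snd g {x, y} \<bullet> unit_vec x y) g =
    (\<Sum>i\<in>{x, y}. (if i = x then - (1 / m x) else 1 / m y) * fst g i)"
proof -
  note neq = edge_neq[OF xy]
  have "gen (\<lambda>g. snd g {x, y} \<bullet> unit_vec x y) g = (\<Sum>ev\<in>{NodeEv x, NodeEv y}.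
      ev_rate k m g ev * (snd (ev_target E V0 g ev) {x, y} \<bullet> unit_vec x y - snd g {x, y} \<bullet> unit_vec x y))"
  proof (rule gen_eq_sum[OF g])
    show "{NodeEv x, NodeEv y} \<subseteq> events V E"
      using edge_in_V[OF xy] by (auto simp: events_def)
    fix ev assume "ev \<in> events V E - {NodeEv x, NodeEv y}"
    then show "snd (ev_target E V0 g ev) {x, y} \<bullet> unit_vec x y = snd g {x, y} \<bullet> unit_vec x y"
      by (cases ev) auto
  qed simp
  also have "\<dots> = - (\<bar>fst g x\<bar> * sgn (fst g x)) / m x + \<bar>fst g y\<bar> * sgn (fst g y) / m y"
    using neq xy by (simp add: other_end_simps inner_add_left inner_diff_left inner_unit_vec unit_vec_commute[of y x])
  also have "\<dots> = - fst g x / m x + fst g y / m y"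
    by (simp only: abs_mult_sgn)
  finally show ?thesis
    using neq by simp
qed

section \<open>Evolution equations for the means\<close>

lemma exp_node_deriv:
  assumes f: "f \<in> conf V E" and x: "x \<in> V0" and t: "t \<ge> 0"
  shows "((\<lambda>s. exp_node V E k m V0 f s x) has_real_derivative
     (\<Sum>y\<in>{y. {x, y} \<in> E}. k {x, y} * (unit_vec x y \<bullet> exp_edge V E k m V0 f t {x, y}))) (at t within {0..})"
proof -
  let ?N = "{y. {x, y} \<in> E}"
  have fin: "finite ?N"
    using finite_nbrs x V_split by auto
  \<comment> \<open>On \<open>conf V E\<close> the generator returns a finite combination of edge
    coordinates, so it again has linear growth, as \<open>expect_deriv\<close> demands.\<close>
  have lin: "lin_growth (gen (\<lambda>g. fst g x))"
    by (rule lin_growth_cong[OF lin_growth_sum[OF fin lin_growth_edge] gen_node]) (use x in auto)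
  have "expect (gen (\<lambda>g. fst g x)) t f = expect (\<lambda>g. \<Sum>y\<in>?N. k {x, y} * (snd g {x, y} \<bullet> unit_vec x y)) t f"
    by (rule expect_cong[OF gen_node]) (use assms in auto)
  also have "\<dots> = (\<Sum>y\<in>?N. k {x, y} * expect (\<lambda>g. snd g {x, y} \<bullet> unit_vec x y) t f)"
    by (rule expect_sum[OF fin lin_growth_edge f t])
  also have "\<dots> = (\<Sum>y\<in>?N. k {x, y} * (unit_vec x y \<bullet> exp_edge V E k m V0 f t {x, y}))"
    by (rule sum.cong) (use edge_neq in \<open>auto simp: exp_edge_eq[OF _ f t] inner_unit_vec\<close>)
  finally show ?thesis
    using expect_deriv[OF lin_growth_node lin f t] by (simp add: exp_node_eq)
qed

lemma exp_edge_deriv: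
  assumes f: "f \<in> conf V E" and xy: "{x, y} \<in> E" and t: "t \<ge> 0"
  shows "((\<lambda>s. exp_edge V E k m V0 f s {x, y}) has_vector_derivative
     ((exp_node V E k m V0 f t y / m y - exp_node V E k m V0 f t x / m x) *\<^sub>R unit_vec x y)) (at t within {0..})"
proof -
  let ?\<phi> = "\<lambda>g. snd g {x, y} \<bullet> unit_vec x y"
  let ?c = "\<lambda>i. if i = x then - (1 / m x) else 1 / m y"
  have lin: "lin_growth (gen ?\<phi>)"
    by (rule lin_growth_cong[OF lin_growth_sum[OF _ lin_growth_node] gen_edge]) (use xy in auto)
  have "expect (gen ?\<phi>) t f = expect (\<lambda>g. \<Sum>i\<in>{x, y}. ?c i * fst g i) t f"
    by (rule expect_cong[OF gen_edge]) (use assms in auto)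
  also have "\<dots> = (\<Sum>i\<in>{x, y}. ?c i * expect (\<lambda>g. fst g i) t f)"
    by (rule expect_sum[OF _ lin_growth_node f t]) simp
  also have "\<dots> = exp_node V E k m V0 f t y / m y - exp_node V E k m V0 f t x / m x"
    using edge_neq[OF xy] by (simp add: exp_node_eq)
  finally have "((\<lambda>s. expect ?\<phi> s f) has_vector_derivative
      (exp_node V E k m V0 f t y / m y - exp_node V E k m V0 f t x / m x)) (at t within {0..})"
    using expect_deriv[OF lin_growth_edge lin f t]
    by (simp add: has_real_derivative_iff_has_vector_derivative)
  \<comment> \<open>The scalar derivative is carried along the fixed direction
    \<open>unit_vec x y\<close>; the identity with \<open>exp_edge\<close> holds for nonnegative
    times, which is enough within \<open>{0..}\<close>.\<close>
  from bounded_linear.has_vector_derivative[OF bounded_linear_scaleR_left this]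
  show ?thesis
    by (rule has_vector_derivative_transform[rotated 2]) (use t in \<open>auto simp: exp_edge_eq[OF xy f]\<close>)
qed

end

theorem theorem3p2:
  fixes V :: "('h::{real_inner,complete_space}) set"
    and E :: "'h set set" and k :: "'h set \<Rightarrow> real" and m :: "'h \<Rightarrow> real"
    and V0 V1 :: "'h set" and f :: "'h state"
  assumes G: "graph_ok V E k m V0 V1"
    and f: "f \<in> F0 V E"
  shows
    "(\<forall>x\<in>V0. \<forall>t\<ge>0.
        ((\<lambda>s. exp_node V E k m V0 f s x) has_real_derivative
           (\<Sum>y\<in>{y. {x, y} \<in> E}. k {x, y} * (unit_vec x y \<bullet> exp_edge V E k m V0 f t {x, y})))
        (at t within {0..})) \<and>
     (\<forall>x y. {x, y} \<in> E \<longrightarrow> (\<forall>t\<ge>0.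
        ((\<lambda>s. exp_edge V E k m V0 f s {x, y}) has_vector_derivative
           ((exp_node V E k m V0 f t y / m y - exp_node V E k m V0 f t x / m x) *\<^sub>R unit_vec x y))
        (at t within {0..}))) \<and>
     (\<forall>x\<in>V. exp_node V E k m V0 f 0 x = fst f x) \<and>
     (\<forall>\<epsilon>\<in>E. exp_edge V E k m V0 f 0 \<epsilon> = snd f \<epsilon>) \<and>
     (\<forall>x\<in>V1. \<forall>t\<ge>0. exp_node V E k m V0 f t x = fst f x)"
proof -
  obtain D where D: "\<And>x. x \<in> V \<Longrightarrow> finite {y. {x, y} \<in> E} \<and> card {y. {x, y} \<in> E} \<le> D"
  proof -
    have "\<exists>D::nat. \<forall>x\<in>V. finite {y. {x, y} \<in> E} \<and> card {y. {x, y} \<in> E} \<le> D"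
      using G by (simp add: graph_ok_def)
    then show ?thesis
      using that by meson
  qed
  obtain M where M: "\<And>x. x \<in> V \<Longrightarrow> 1 / m x \<le> M" "\<And>\<epsilon>. \<epsilon> \<in> E \<Longrightarrow> k \<epsilon> \<le> M"
  proof -
    have "\<exists>M. (\<forall>x\<in>V. 1 / m x \<le> M) \<and> (\<forall>\<epsilon>\<in>E. k \<epsilon> \<le> M)"
      using G by (simp add: graph_ok_def)
    then show ?thesis
      using that by meson
  qed
  \<comment> \<open>If \<open>V\<close> is empty, the bound \<open>M\<close> may be negative; the
    maximum with 0 secures the sign condition of the locale.\<close>
  interpret particle_system V E k m V0 V1 D "max M 0"
  proof
    show "\<And>x. x \<in> V \<Longrightarrow> 1 / m x \<le> max M 0" "\<And>\<epsilon>. \<epsilon> \<in> E \<Longrightarrow> k \<epsilon> \<le> max M 0"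
      using M by (simp_all add: le_max_iff_disj)
  qed (use G D in \<open>simp_all add: graph_ok_def\<close>)
  have f: "f \<in> conf V E"
    using f F0_subset_conf by blast
  show ?thesis
  proof (intro conjI ballI allI impI)
    show "exp_node V E k m V0 f 0 x = fst f x" for x
      using expect_time_0[OF lin_growth_node f] by (simp add: exp_node_eq)
    show "exp_node V E k m V0 f t x = fst f x" if "x \<in> V1" "t \<ge> 0" for x t
      using expect_constant[OF lin_growth_node f that(2) gen_node_fixed[OF _ that(1)]]
      by (simp add: exp_node_eq)
    show "exp_edge V E k m V0 f 0 \<epsilon> = snd f \<epsilon>" if \<epsilon>: "\<epsilon> \<in> E" for \<epsilon>
    proof -
      obtain x y where xy: "\<epsilon> = {x, y}"
        using edge_ends[OF \<epsilon>] by blast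
      have xyE: "{x, y} \<in> E"
        using \<epsilon> xy by simp
      show ?thesis
        unfolding xy exp_edge_eq[OF xyE f order.refl] expect_time_0[OF lin_growth_edge f]
        by (rule edge_parallel(1)[OF f xyE, symmetric])
    qed
    show "((\<lambda>s. exp_node V E k m V0 f s x) has_real_derivative
           (\<Sum>y\<in>{y. {x, y} \<in> E}. k {x, y} * (unit_vec x y \<bullet> exp_edge V E k m V0 f t {x, y})))
        (at t within {0..})" if "x \<in> V0" "t \<ge> 0" for x t
      using f that by (rule exp_node_deriv)
    show "((\<lambda>s. exp_edge V E k m V0 f s {x, y}) has_vector_derivative
           ((exp_node V E k m V0 f t y / m y - exp_node V E k m V0 f t x / m x) *\<^sub>R unit_vec x y))
        (at t within {0..})" if "{x, y} \<in> E" "t \<ge> 0" for x y t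
      using f that by (rule exp_edge_deriv)
  qed
qed

end
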